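(* In the setting described in the context, let $\widetilde\Theta_n\times\widetilde\Theta_l$ denote a completion of the control space $\Theta_n\times\Theta_l$ with respect to the energy norm $\|(\sigma_n,\sigma_l)\|_*=\|v_n(\sigma_n)-v_l(\sigma_l)\|_{0,\Omega_o}$. Then the minimization problem $$\min_{(\theta_n,\theta_l)\in\widetilde\Theta_n\times\widetilde\Theta_l} J(\theta_n,\theta_l)$$ has a unique minimizer $(\widetilde\theta_n^*,\widetilde\theta_l^* )\in\widetilde\Theta_n\times\widetilde\Theta_l$ such that $$\widetilde Q(\widetilde\theta_n^*,\widetilde\theta_l^*;\mu_n,\mu_l)=\widetilde F(\mu_n,\mu_l)\qquad\forall\,(\mu_n,\mu_l)\in\widetilde\Theta_n\times\widetilde\Theta_l .$$
   Context: Let $d\in\{2,3\}$. $\|\cdot\|_{s,D}$ is the norm of $H^s(D)$, with $H^0=L^2$; $(\cdot,\cdot)_{0,D}$ is the $L^2(D)$ inner product. Kernel. $\gamma:\mathbb R^d\times\mathbb R^d\to\mathbb R$ is symmetric and nonnegative; for $x\in\omega$, $\gamma(x,y)=0$ whenever $|x-y|>\varepsilon$ (with $\varepsilon>0$ the interaction radius); and there are constants $\gamma_0,\gamma_2>0$ such that for all $x\in\Omega$: $\gamma_0\le\int_{\Omega\cap B_\varepsilon(x)}\gamma(x,y)\,dy$ and $\int_\Omega\gamma(x,y)^2dy\le\gamma_2^2$, where $B_\varepsilon(x)=\{y:|x-y|\le\varepsilon\}$. Put $\mathcal L u(x)=2\int_{\mathbb R^d}(u(y)-u(x))\gamma(x,y)\,dy$.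 The interaction domain of a bounded open set $\omega$ is $\{y\in\mathbb R^d\setminus\omega:\inf_{x\in\omega}|y-x|\le\varepsilon\}$. For a set $D$, $|||v|||_D^2=\frac12\int_D\int_D(v(y)-v(x))^2\gamma(x,y)\,dy\,dx$, $V(D)=\{v\in L^2(D):|||v|||_D<\infty\}$, $V_\tau(D)=\{v\in V(D):v=0\text{ on }\tau\}$. Geometry. $\omega\subset\mathbb R^d$ is bounded, open, with Lipschitz boundary, $\eta$ is its interaction domain, $\Omega=\omega\cup\eta$, $\Gamma=\partial\Omega$. $\omega_n\subset\omega$ is the nonlocal subdomain, with interaction domain $\eta_n$, and $\Omega_n=\omega_n\cup\eta_n\subset\Omega$; $\Omega_l\subset\Omega$ is the local subdomain, with boundary $\Gamma_l$; $\Omega=\Omega_n\cup\Omega_l$ and $\Omega_o=\Omega_n\cap\Omega_l\neq\emptyset$ is the overlap domain. $\eta_D=\eta\cap\eta_n$, $\eta_c=\eta_n\setminus\eta_D$, $\Gamma_D=\Gamma\cap\Gamma_l$, $\Gamma_c=\Gamma_l\setminus\Gamma_D$. Data. $f_n\in L^2(\omega)$, and $f_l=f_n$ on $\omega$, $f_l=0$ on $\eta$. Controls and states. $\Theta_n=\{v|_{\eta_c}:v\in V_{\eta_D}(\Omega_n)\}$ and $\Theta_l=\{v|_{\Gamma_c}:v\in H^1_{\Gamma_D}(\Omega_l)\}$, where $H^1_{\Gamma_D}(\Omega_l)$ is the set of $H^1(\Omega_l)$ functions vanishing on $\Gamma_D$. For $(\theta_n,\theta_l)\in\Theta_n\times\Theta_l$,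 $v_n(\theta_n)\in V_{\eta_D}(\Omega_n)$ and $v_l(\theta_l)\in H^1_{\Gamma_D}(\Omega_l)$ are the (weak) solutions of: $-\mathcal Lv_n=0$ in $\omega_n$, $v_n=\theta_n$ on $\eta_c$, $v_n=0$ on $\eta_D$; and $-\Delta v_l=0$ in $\Omega_l$, $v_l=\theta_l$ on $\Gamma_c$, $v_l=0$ on $\Gamma_D$. $u_n^0,u_l^0$ solve: $-\mathcal Lu_n^0=f_n$ in $\omega_n$, $u_n^0=0$ on $\eta_n$; and $-\Delta u_l^0=f_l$ in $\Omega_l$, $u_l^0=0$ on $\Gamma_l$. (Weak form of $-\mathcal Lu=f$ in $\omega_n$: $\int_{\Omega_n}\int_{\Omega_n}(u(y)-u(x))(z(y)-z(x))\gamma(x,y)\,dy\,dx=\int_{\omega_n}fz\,dx$ for all $z\in V_{\eta_n}(\Omega_n)$.) These problems are uniquely solvable. The states are $u_n(\theta_n)=v_n(\theta_n)+u_n^0$ and $u_l(\theta_l)=v_l(\theta_l)+u_l^0$. Functionals. $J(\theta_n,\theta_l)=\frac12\|u_n(\theta_n)-u_l(\theta_l)\|_{0,\Omega_o}^2$, $Q(\sigma_n,\sigma_l;\mu_n,\mu_l)=(v_n(\sigma_n)-v_l(\sigma_l),v_n(\mu_n)-v_l(\mu_l))_{0,\Omega_o}$, $F(\mu_n,\mu_l)=-(u_n^0-u_l^0,v_n(\mu_n)-v_l(\mu_l))_{0,\Omega_o}$. $Q$ is an inner product on $\Theta_n\times\Theta_l$ with norm $\|\cdot\|_*$, and $Q$,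 $F$ are continuous in this norm. $\widetilde Q$ and $\widetilde F$ are the unique continuous extensions of $Q$ and $F$ to the completion (equal to $Q$, $F$ if the control space is already complete), and $J$ is extended there by $J(\theta)=\frac12\widetilde Q(\theta;\theta)-\widetilde F(\theta)+\frac12\|u_n^0-u_l^0\|_{0,\Omega_o}^2$. *)

theory Defs
  imports "HOL-Analysis.Analysis"
begin

text \<open>
  Elements of Lebesgue and Sobolev spaces are represented by Borel functions on the whole space
  whose values outside the domain are irrelevant; equality of elements is equality almost
  everywhere. Every class of functions has a Borel representative.
\<close>

definition L2 :: "'a::euclidean_space set \<Rightarrow> ('a \<Rightarrow> 'b::euclidean_space) set" where
  "L2 D = {f. set_borel_measurable lborel D f \<and>
              (\<integral>\<^sup>+x\<in>D. ennreal ((norm (f x))\<^sup>2) \<partial>lborel) < \<infinity>}"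

definition L2_inner :: "'a::euclidean_space set \<Rightarrow> ('a \<Rightarrow> real) \<Rightarrow> ('a \<Rightarrow> real) \<Rightarrow> real" where
  "L2_inner D f g = (LINT x:D|lborel. f x * g x)"

definition L2_norm :: "'a::euclidean_space set \<Rightarrow> ('a \<Rightarrow> real) \<Rightarrow> real" where
  "L2_norm D f = sqrt (L2_inner D f f)"

definition restr :: "'a set \<Rightarrow> ('a \<Rightarrow> real) \<Rightarrow> 'a \<Rightarrow> real" where
  "restr D f = (\<lambda>x. if x \<in> D then f x else 0)"

text \<open>Sets whose boundary is locally the graph of a Lipschitz function over the hyperplane
  orthogonal to \<open>e\<close>, with the set lying on one side of it.\<close>

definition lipschitz_boundary :: "'a::euclidean_space set \<Rightarrow> bool" where
  "lipschitz_boundary D \<longleftrightarrow>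
     (\<forall>p\<in>frontier D. \<exists>r>0. \<exists>e L. \<exists>g::'a \<Rightarrow> real. norm e = 1 \<and> L-lipschitz_on UNIV g \<and>
        D \<inter> ball p r = {x \<in> ball p r. x \<bullet> e > g (x - (x \<bullet> e) *\<^sub>R e)})"

text \<open>Surface measure: the normalised Hausdorff measure, restricted to Borel sets.\<close>

definition hausdorff_outer :: "real \<Rightarrow> 'a::euclidean_space set \<Rightarrow> ennreal" where
  "hausdorff_outer s A =
     ennreal (unit_ball_vol s / 2 powr s) *
     (SUP \<delta>\<in>{0<..}. INF C\<in>{C :: nat \<Rightarrow> 'a set. A \<subseteq> (\<Union>i. C i) \<and>
                                   (\<forall>i. bounded (C i) \<and> diameter (C i) \<le> \<delta>)}.
        (\<Sum>i. ennreal (diameter (C i) powr s)))"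

definition surface_measure :: "'a::euclidean_space measure" where
  "surface_measure = measure_of UNIV (sets borel) (hausdorff_outer (real DIM('a) - 1))"

primrec C_k :: "nat \<Rightarrow> ('a::euclidean_space \<Rightarrow> real) \<Rightarrow> bool" where
  "C_k 0 f \<longleftrightarrow> continuous_on UNIV f"
| "C_k (Suc k) f \<longleftrightarrow> (\<forall>x. f differentiable (at x)) \<and>
                     (\<forall>b\<in>Basis. C_k k (\<lambda>x. frechet_derivative f (at x) b))"

definition C_inf :: "('a::euclidean_space \<Rightarrow> real) \<Rightarrow> bool" where
  "C_inf f \<longleftrightarrow> (\<forall>k. C_k k f)"

definition grad :: "('a::euclidean_space \<Rightarrow> real) \<Rightarrow> 'a \<Rightarrow> 'a" where
  "grad f x = (\<Sum>b\<in>Basis. frechet_derivative f (at x) b *\<^sub>R b)"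

definition test_function :: "'a::euclidean_space set \<Rightarrow> ('a \<Rightarrow> real) \<Rightarrow> bool" where
  "test_function U f \<longleftrightarrow>
     C_inf f \<and> compact (closure {x. f x \<noteq> 0}) \<and> closure {x. f x \<noteq> 0} \<subseteq> U"

text \<open>The domain \<open>D\<close> of a Sobolev function may contain some of its boundary points; derivatives
  are those on the open set \<open>interior D\<close>. The weak gradient is a relation, because it is
  determined only almost everywhere.\<close>

definition weak_grad :: "'a::euclidean_space set \<Rightarrow> ('a \<Rightarrow> real) \<Rightarrow> ('a \<Rightarrow> 'a) \<Rightarrow> bool" where
  "weak_grad D v G \<longleftrightarrow> G \<in> L2 (interior D) \<and>
     (\<forall>\<phi>. test_function (interior D) \<phi> \<longrightarrow>
        (LINT x:interior D|lborel. v x *\<^sub>R grad \<phi> x) = - (LINT x:interior D|lborel. \<phi> x *\<^sub>R G x))"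

definition H1 :: "'a::euclidean_space set \<Rightarrow> ('a \<Rightarrow> real) set" where
  "H1 D = {v \<in> L2 D. \<exists>G. weak_grad D v G}"

text \<open>\<open>g\<close> is the trace of \<open>v\<close> on the boundary of \<open>D\<close>: the trace operator is the continuous
  extension, from \<open>H1\<close> to square integrable functions for the surface measure, of the restriction
  to the boundary of functions that are smooth up to the boundary.\<close>

definition has_trace :: "'a::euclidean_space set \<Rightarrow> ('a \<Rightarrow> real) \<Rightarrow> ('a \<Rightarrow> real) \<Rightarrow> bool" where
  "has_trace D v g \<longleftrightarrow> v \<in> H1 D \<and> set_borel_measurable borel (frontier D) g \<and>
     (\<exists>G \<phi>. weak_grad D v G \<and> (\<forall>k::nat. C_inf (\<phi> k)) \<and>
        (\<lambda>k. (\<integral>\<^sup>+x\<in>D. ennreal ((\<phi> k x - v x)\<^sup>2) \<partial>lborel)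
            + (\<integral>\<^sup>+x\<in>interior D. ennreal ((norm (grad (\<phi> k) x - G x))\<^sup>2) \<partial>lborel))
          \<longlonglongrightarrow> 0 \<and>
        (\<lambda>k. \<integral>\<^sup>+x\<in>frontier D. ennreal ((\<phi> k x - g x)\<^sup>2) \<partial>surface_measure) \<longlonglongrightarrow> 0)"

definition trace_eq ::
    "'a::euclidean_space set \<Rightarrow> 'a set \<Rightarrow> ('a \<Rightarrow> real) \<Rightarrow> ('a \<Rightarrow> real) \<Rightarrow> bool" where
  "trace_eq D \<tau> v \<theta> \<longleftrightarrow> (\<exists>g. has_trace D v g \<and> (AE x in surface_measure. x \<in> \<tau> \<longrightarrow> g x = \<theta> x))"

definition H1_van :: "'a::euclidean_space set \<Rightarrow> 'a set \<Rightarrow> ('a \<Rightarrow> real) set" where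
  "H1_van D \<tau> = {v \<in> H1 D. trace_eq D \<tau> v (\<lambda>x. 0)}"


text \<open>Points at distance at most \<open>r\<close> from \<open>W\<close>. The first conjunct is there because
  \<open>infdist x {} = 0\<close>, whereas the infimum over the empty set is meant to be infinite.\<close>

definition interaction_domain :: "real \<Rightarrow> 'a::euclidean_space set \<Rightarrow> 'a set" where
  "interaction_domain r W = {y. W \<noteq> {} \<and> y \<notin> W \<and> infdist y W \<le> r}"

record 'a coupling =
  radius :: real
  kern :: "'a \<Rightarrow> 'a \<Rightarrow> real"
  om :: "'a set"
  om_n :: "'a set"
  Om_l :: "'a set"
  src :: "'a \<Rightarrow> real"

definition eta :: "('a::euclidean_space) coupling \<Rightarrow> 'a set" where
  "eta S = interaction_domain (radius S) (om S)"

definition Om :: "('a::euclidean_space) coupling \<Rightarrow> 'a set" where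
  "Om S = om S \<union> eta S"

definition eta_n :: "('a::euclidean_space) coupling \<Rightarrow> 'a set" where
  "eta_n S = interaction_domain (radius S) (om_n S)"

definition Om_n :: "('a::euclidean_space) coupling \<Rightarrow> 'a set" where
  "Om_n S = om_n S \<union> eta_n S"

definition Om_o :: "('a::euclidean_space) coupling \<Rightarrow> 'a set" where
  "Om_o S = Om_n S \<inter> Om_l S"

definition eta_D :: "('a::euclidean_space) coupling \<Rightarrow> 'a set" where
  "eta_D S = eta S \<inter> eta_n S"

definition eta_c :: "('a::euclidean_space) coupling \<Rightarrow> 'a set" where
  "eta_c S = eta_n S - eta_D S"

definition Gamma_l :: "('a::euclidean_space) coupling \<Rightarrow> 'a set" where
  "Gamma_l S = frontier (Om_l S)"

definition Gamma_D :: "('a::euclidean_space) coupling \<Rightarrow> 'a set" where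
  "Gamma_D S = frontier (Om S) \<inter> Gamma_l S"

definition Gamma_c :: "('a::euclidean_space) coupling \<Rightarrow> 'a set" where
  "Gamma_c S = Gamma_l S - Gamma_D S"

definition src_l :: "('a::euclidean_space) coupling \<Rightarrow> 'a \<Rightarrow> real" where
  "src_l S x = (if x \<in> om S then src S x else 0)"

text \<open>Since \<open>Om S\<close> is closed, the local subdomain cannot in general be taken open if
  \<open>Om S\<close> is to be the union of the two subdomains. It is therefore an open set together with some
  of its boundary points.\<close>

definition coupling_setting :: "('a::euclidean_space) coupling \<Rightarrow> bool" where
  "coupling_setting S \<longleftrightarrow>
     radius S > 0 \<and>
     open (om S) \<and> bounded (om S) \<and> lipschitz_boundary (om S) \<and>
     open (om_n S) \<and> om_n S \<subseteq> om S \<and>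
     Om_l S \<in> sets borel \<and> Om_l S \<subseteq> closure (interior (Om_l S)) \<and>
     Om S = Om_n S \<union> Om_l S \<and> Om_o S \<noteq> {} \<and>
     (\<lambda>(x, y). kern S x y) \<in> borel_measurable borel \<and>
     (\<forall>x y. kern S x y = kern S y x) \<and> (\<forall>x y. kern S x y \<ge> 0) \<and>
     (\<forall>x\<in>om S. \<forall>y. norm (x - y) > radius S \<longrightarrow> kern S x y = 0) \<and>
     (\<exists>\<gamma>\<^sub>0>0. \<forall>x\<in>Om S.
        ennreal \<gamma>\<^sub>0 \<le> (\<integral>\<^sup>+y\<in>Om S \<inter> cball x (radius S). ennreal (kern S x y) \<partial>lborel)) \<and>
     (\<exists>\<gamma>\<^sub>2>0. \<forall>x\<in>Om S.
        (\<integral>\<^sup>+y\<in>Om S. ennreal ((kern S x y)\<^sup>2) \<partial>lborel) \<le> ennreal (\<gamma>\<^sub>2\<^sup>2)) \<and>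
     src S \<in> L2 (om S)"

definition nl_energy :: "('a::euclidean_space) coupling \<Rightarrow> 'a set \<Rightarrow> ('a \<Rightarrow> real) \<Rightarrow> ennreal" where
  "nl_energy S D v =
     (\<integral>\<^sup>+x\<in>D. (\<integral>\<^sup>+y\<in>D. ennreal ((v y - v x)\<^sup>2 * kern S x y) \<partial>lborel) \<partial>lborel) / 2"

definition V :: "('a::euclidean_space) coupling \<Rightarrow> 'a set \<Rightarrow> ('a \<Rightarrow> real) set" where
  "V S D = {v \<in> L2 D. nl_energy S D v < \<infinity>}"

definition V_van :: "('a::euclidean_space) coupling \<Rightarrow> 'a set \<Rightarrow> 'a set \<Rightarrow> ('a \<Rightarrow> real) set" where
  "V_van S D \<tau> = {v \<in> V S D. AE x in lborel. x \<in> \<tau> \<longrightarrow> v x = 0}"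

definition nl_weak :: "('a::euclidean_space) coupling \<Rightarrow> ('a \<Rightarrow> real) \<Rightarrow> ('a \<Rightarrow> real) \<Rightarrow> bool" where
  "nl_weak S f u \<longleftrightarrow>
     (\<forall>z\<in>V_van S (Om_n S) (eta_n S).
        (LINT x:Om_n S|lborel. (LINT y:Om_n S|lborel. (u y - u x) * (z y - z x) * kern S x y))
          = (LINT x:om_n S|lborel. f x * z x))"

definition loc_weak :: "('a::euclidean_space) coupling \<Rightarrow> ('a \<Rightarrow> real) \<Rightarrow> ('a \<Rightarrow> real) \<Rightarrow> bool" where
  "loc_weak S f u \<longleftrightarrow>
     (\<exists>G. weak_grad (Om_l S) u G \<and>
        (\<forall>z\<in>H1_van (Om_l S) (Gamma_l S). \<forall>Z. weak_grad (Om_l S) z Z \<longrightarrow>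
           (LINT x:interior (Om_l S)|lborel. G x \<bullet> Z x) = (LINT x:Om_l S|lborel. f x * z x)))"

text \<open>Controls are extended by zero outside the sets on which they are given.\<close>

definition Theta_n :: "('a::euclidean_space) coupling \<Rightarrow> ('a \<Rightarrow> real) set" where
  "Theta_n S = restr (eta_c S) ` V_van S (Om_n S) (eta_D S)"

definition Theta_l :: "('a::euclidean_space) coupling \<Rightarrow> ('a \<Rightarrow> real) set" where
  "Theta_l S =
     {restr (Gamma_c S) g |g v. v \<in> H1_van (Om_l S) (Gamma_D S) \<and> has_trace (Om_l S) v g}"

type_synonym 'a control = "('a \<Rightarrow> real) \<times> ('a \<Rightarrow> real)"

definition Theta :: "('a::euclidean_space) coupling \<Rightarrow> 'a control set" where
  "Theta S = Theta_n S \<times> Theta_l S"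

definition solves_vn :: "('a::euclidean_space) coupling \<Rightarrow> ('a \<Rightarrow> real) \<Rightarrow> ('a \<Rightarrow> real) \<Rightarrow> bool" where
  "solves_vn S \<theta> v \<longleftrightarrow> v \<in> V_van S (Om_n S) (eta_D S) \<and>
     (AE x in lborel. x \<in> eta_c S \<longrightarrow> v x = \<theta> x) \<and> nl_weak S (\<lambda>x. 0) v"

definition solves_vl :: "('a::euclidean_space) coupling \<Rightarrow> ('a \<Rightarrow> real) \<Rightarrow> ('a \<Rightarrow> real) \<Rightarrow> bool" where
  "solves_vl S \<theta> v \<longleftrightarrow> v \<in> H1_van (Om_l S) (Gamma_D S) \<and>
     trace_eq (Om_l S) (Gamma_c S) v \<theta> \<and> loc_weak S (\<lambda>x. 0) v"

definition solves_un0 :: "('a::euclidean_space) coupling \<Rightarrow> ('a \<Rightarrow> real) \<Rightarrow> bool" where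
  "solves_un0 S u \<longleftrightarrow> u \<in> V_van S (Om_n S) (eta_n S) \<and> nl_weak S (src S) u"

definition solves_ul0 :: "('a::euclidean_space) coupling \<Rightarrow> ('a \<Rightarrow> real) \<Rightarrow> bool" where
  "solves_ul0 S u \<longleftrightarrow> u \<in> H1_van (Om_l S) (Gamma_l S) \<and> loc_weak S (src_l S) u"

definition unique_ae :: "'a::euclidean_space set \<Rightarrow> (('a \<Rightarrow> real) \<Rightarrow> bool) \<Rightarrow> bool" where
  "unique_ae D P \<longleftrightarrow>
     (\<exists>v. P v) \<and> (\<forall>v w. P v \<longrightarrow> P w \<longrightarrow> (AE x in lborel. x \<in> D \<longrightarrow> v x = w x))"

text \<open>For a kernel satisfying only the conditions in \<^const>\<open>coupling_setting\<close>, uniqueness can fail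
  in the nonlocal problems, so that unique solvability is a standing hypothesis of its own.\<close>

definition uniquely_solvable :: "('a::euclidean_space) coupling \<Rightarrow> bool" where
  "uniquely_solvable S \<longleftrightarrow>
     (\<forall>\<theta>\<in>Theta_n S. unique_ae (Om_n S) (solves_vn S \<theta>)) \<and>
     (\<forall>\<theta>\<in>Theta_l S. unique_ae (Om_l S) (solves_vl S \<theta>)) \<and>
     unique_ae (Om_n S) (solves_un0 S) \<and>
     unique_ae (Om_l S) (solves_ul0 S)"

definition v_n :: "('a::euclidean_space) coupling \<Rightarrow> ('a \<Rightarrow> real) \<Rightarrow> 'a \<Rightarrow> real" where
  "v_n S \<theta> = (SOME v. solves_vn S \<theta> v)"

definition v_l :: "('a::euclidean_space) coupling \<Rightarrow> ('a \<Rightarrow> real) \<Rightarrow> 'a \<Rightarrow> real" where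
  "v_l S \<theta> = (SOME v. solves_vl S \<theta> v)"

definition u_n0 :: "('a::euclidean_space) coupling \<Rightarrow> 'a \<Rightarrow> real" where
  "u_n0 S = (SOME u. solves_un0 S u)"

definition u_l0 :: "('a::euclidean_space) coupling \<Rightarrow> 'a \<Rightarrow> real" where
  "u_l0 S = (SOME u. solves_ul0 S u)"

definition u_n :: "('a::euclidean_space) coupling \<Rightarrow> ('a \<Rightarrow> real) \<Rightarrow> 'a \<Rightarrow> real" where
  "u_n S \<theta> x = v_n S \<theta> x + u_n0 S x"

definition u_l :: "('a::euclidean_space) coupling \<Rightarrow> ('a \<Rightarrow> real) \<Rightarrow> 'a \<Rightarrow> real" where
  "u_l S \<theta> x = v_l S \<theta> x + u_l0 S x"

definition v_diff :: "('a::euclidean_space) coupling \<Rightarrow> 'a control \<Rightarrow> 'a \<Rightarrow> real" where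
  "v_diff S \<sigma> x = v_n S (fst \<sigma>) x - v_l S (snd \<sigma>) x"

definition u0_diff :: "('a::euclidean_space) coupling \<Rightarrow> 'a \<Rightarrow> real" where
  "u0_diff S x = u_n0 S x - u_l0 S x"

definition J :: "('a::euclidean_space) coupling \<Rightarrow> 'a control \<Rightarrow> real" where
  "J S \<theta> = (1/2) * (L2_norm (Om_o S) (\<lambda>x. u_n S (fst \<theta>) x - u_l S (snd \<theta>) x))\<^sup>2"

definition Q :: "('a::euclidean_space) coupling \<Rightarrow> 'a control \<Rightarrow> 'a control \<Rightarrow> real" where
  "Q S \<sigma> \<mu> = L2_inner (Om_o S) (v_diff S \<sigma>) (v_diff S \<mu>)"

definition F :: "('a::euclidean_space) coupling \<Rightarrow> 'a control \<Rightarrow> real" where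
  "F S \<mu> = - L2_inner (Om_o S) (u0_diff S) (v_diff S \<mu>)"

definition energy_norm :: "('a::euclidean_space) coupling \<Rightarrow> 'a control \<Rightarrow> real" where
  "energy_norm S \<sigma> = L2_norm (Om_o S) (v_diff S \<sigma>)"

definition lincomb :: "real \<Rightarrow> 'a control \<Rightarrow> real \<Rightarrow> 'a control \<Rightarrow> 'a control" where
  "lincomb a \<sigma> b \<mu> =
     ((\<lambda>x. a * fst \<sigma> x + b * fst \<mu> x), (\<lambda>x. a * snd \<sigma> x + b * snd \<mu> x))"

text \<open>A completion of the control space: a Banach space, given as a type, with a linear isometry
  of the control space onto a dense subspace. Being isometric, \<open>\<iota>\<close> identifies controls that are
  equal almost everywhere.\<close>

definition is_completion ::
    "('a::euclidean_space) coupling \<Rightarrow> ('a control \<Rightarrow> 'h::banach) \<Rightarrow> bool" where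
  "is_completion S \<iota> \<longleftrightarrow>
     (\<forall>\<sigma>\<in>Theta S. \<forall>\<mu>\<in>Theta S. \<forall>a b. \<iota> (lincomb a \<sigma> b \<mu>) = a *\<^sub>R \<iota> \<sigma> + b *\<^sub>R \<iota> \<mu>) \<and>
     (\<forall>\<sigma>\<in>Theta S. norm (\<iota> \<sigma>) = energy_norm S \<sigma>) \<and>
     closure (\<iota> ` Theta S) = UNIV"

definition Q_ext ::
    "('a::euclidean_space) coupling \<Rightarrow> ('a control \<Rightarrow> 'h::banach) \<Rightarrow> 'h \<times> 'h \<Rightarrow> real" where
  "Q_ext S \<iota> = (THE q. continuous_on UNIV q \<and>
                       (\<forall>\<sigma>\<in>Theta S. \<forall>\<mu>\<in>Theta S. q (\<iota> \<sigma>, \<iota> \<mu>) = Q S \<sigma> \<mu>))"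

definition F_ext ::
    "('a::euclidean_space) coupling \<Rightarrow> ('a control \<Rightarrow> 'h::banach) \<Rightarrow> 'h \<Rightarrow> real" where
  "F_ext S \<iota> = (THE l. continuous_on UNIV l \<and> (\<forall>\<mu>\<in>Theta S. l (\<iota> \<mu>) = F S \<mu>))"

lemma L2_mono:
  assumes "f \<in> L2 D" "E \<subseteq> D" "E \<in> sets borel"
  shows "f \<in> L2 E"
proof -
  have m: "set_borel_measurable lborel E f"
    using assms set_borel_measurable_subset[of lborel D f E] by (auto simp: L2_def)
  have "(\<integral>\<^sup>+x\<in>E. ennreal ((norm (f x))\<^sup>2) \<partial>lborel) \<le> (\<integral>\<^sup>+x\<in>D. ennreal ((norm (f x))\<^sup>2) \<partial>lborel)"
    using assms(2) by (intro nn_integral_mono) (auto simp: indicator_def)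
  then show ?thesis using assms(1) m by (auto simp: L2_def)
qed

lemma L2_mult_integrable:
  fixes f g :: "'a::euclidean_space \<Rightarrow> real"
  assumes "f \<in> L2 D" "g \<in> L2 D"
  shows "set_integrable lborel D (\<lambda>x. f x * g x)"
proof -
  have sq: "set_integrable lborel D (\<lambda>x. (h x)\<^sup>2)" if h: "h \<in> L2 D" for h :: "'a \<Rightarrow> real"
  proof -
    have [measurable]: "(\<lambda>x. indicator D x * h x) \<in> borel_measurable lborel"
      using h by (simp add: L2_def set_borel_measurable_def)
    have e: "(\<lambda>x. indicator D x * (h x)\<^sup>2) = (\<lambda>x. (indicator D x * h x)\<^sup>2)"
      by (auto simp: indicator_def)
    have "integrable lborel (\<lambda>x. (indicator D x * h x)\<^sup>2)"
    proof (rule integrableI_bounded)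
      have "(\<integral>\<^sup>+x. ennreal (norm ((indicator D x * h x)\<^sup>2)) \<partial>lborel)
          = (\<integral>\<^sup>+x\<in>D. ennreal ((norm (h x))\<^sup>2) \<partial>lborel)"
        by (intro nn_integral_cong) (auto simp: indicator_def)
      then show "(\<integral>\<^sup>+x. ennreal (norm ((indicator D x * h x)\<^sup>2)) \<partial>lborel) < \<infinity>"
        using h by (simp add: L2_def)
    qed simp
    then show ?thesis by (simp add: set_integrable_def e)
  qed
  have [measurable]: "(\<lambda>x. indicator D x * f x) \<in> borel_measurable lborel"
       "(\<lambda>x. indicator D x * g x) \<in> borel_measurable lborel"
    using assms by (simp_all add: L2_def set_borel_measurable_def)
  have e: "(\<lambda>x. indicator D x * (f x * g x)) = (\<lambda>x. (indicator D x * f x) * (indicator D x * g x))"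
    by (auto simp: indicator_def)
  have "integrable lborel (\<lambda>x. (indicator D x * f x) * (indicator D x * g x))"
  proof (rule Bochner_Integration.integrable_bound)
    show "integrable lborel (\<lambda>x. indicator D x *\<^sub>R (f x)\<^sup>2 + indicator D x *\<^sub>R (g x)\<^sup>2)"
      using sq[OF assms(1)] sq[OF assms(2)] by (simp add: set_integrable_def)
    have "\<bar>a * b\<bar> \<le> a\<^sup>2 + b\<^sup>2" for a b :: real
    proof -
      have "2 * \<bar>a * b\<bar> \<le> a\<^sup>2 + b\<^sup>2"
        using sum_squares_bound[of "\<bar>a\<bar>" "\<bar>b\<bar>"] by (simp only: abs_mult power2_abs mult.assoc)
      then show ?thesis using abs_ge_zero[of "a * b"] by linarith
    qed
    then show "AE x in lborel. norm ((indicator D x * f x) * (indicator D x * g x))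
        \<le> norm (indicator D x *\<^sub>R (f x)\<^sup>2 + indicator D x *\<^sub>R (g x)\<^sup>2)"
      by (intro AE_I2) (simp add: indicator_def)
    show "(\<lambda>x. (indicator D x * f x) * (indicator D x * g x)) \<in> borel_measurable lborel"
      by (rule borel_measurable_times) fact+
  qed
  then show ?thesis by (simp add: set_integrable_def e)
qed

lemma closed_nbhd:
  assumes "open W"
  shows "W \<union> interaction_domain r W \<in> sets borel"
proof (cases "W = {}")
  case False
  have "closed {y. infdist y W \<le> r}"
    by (intro closed_Collect_le continuous_intros)
  then have "W \<union> ({y. infdist y W \<le> r} - W) \<in> sets borel"
    using assms by (intro sets.Un sets.Diff borel_closed borel_open)
  moreover have "interaction_domain r W = {y. infdist y W \<le> r} - W"
    using False by (auto simp: interaction_domain_def)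
  ultimately show ?thesis by simp
qed (simp add: interaction_domain_def)

lemma J_expansion:
  assumes S: "coupling_setting S" "uniquely_solvable S" and \<theta>: "\<theta> \<in> Theta S"
  shows "J S \<theta> = (1/2) * Q S \<theta> \<theta> - F S \<theta> + (1/2) * (L2_norm (Om_o S) (u0_diff S))\<^sup>2"
proof -
  have Oo: "Om_o S \<in> sets borel"
    using S(1) closed_nbhd[of "om_n S" "radius S"]
    by (auto simp: coupling_setting_def Om_o_def Om_n_def eta_n_def)
  have "solves_vn S (fst \<theta>) (v_n S (fst \<theta>))" "solves_vl S (snd \<theta>) (v_l S (snd \<theta>))"
    "solves_un0 S (u_n0 S)" "solves_ul0 S (u_l0 S)"
    using S(2) \<theta> unfolding v_n_def v_l_def u_n0_def u_l0_def uniquely_solvable_def unique_ae_def Theta_def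
    by (auto simp only: mem_Times_iff intro!: someI_ex[of "solves_vn S (fst \<theta>)"]
        someI_ex[of "solves_vl S (snd \<theta>)"] someI_ex[of "solves_un0 S"] someI_ex[of "solves_ul0 S"])
  then have "v_n S (fst \<theta>) \<in> L2 (Om_n S)" "v_l S (snd \<theta>) \<in> L2 (Om_l S)"
    "u_n0 S \<in> L2 (Om_n S)" "u_l0 S \<in> L2 (Om_l S)"
    by (auto simp: solves_vn_def solves_vl_def solves_un0_def solves_ul0_def V_van_def V_def H1_van_def H1_def)
  then have m: "v_n S (fst \<theta>) \<in> L2 (Om_o S)" "v_l S (snd \<theta>) \<in> L2 (Om_o S)"
    "u_n0 S \<in> L2 (Om_o S)" "u_l0 S \<in> L2 (Om_o S)"
    using L2_mono[OF _ _ Oo] by (auto simp: Om_o_def)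
  define a b c d where abcd: "a = v_n S (fst \<theta>)" "b = v_l S (snd \<theta>)" "c = u_n0 S" "d = u_l0 S"
  note [simp] = L2_mult_integrable[OF m(1) m(1), folded abcd] L2_mult_integrable[OF m(1) m(2), folded abcd]
    L2_mult_integrable[OF m(1) m(3), folded abcd] L2_mult_integrable[OF m(1) m(4), folded abcd]
    L2_mult_integrable[OF m(2) m(2), folded abcd] L2_mult_integrable[OF m(2) m(3), folded abcd]
    L2_mult_integrable[OF m(2) m(4), folded abcd] L2_mult_integrable[OF m(3) m(3), folded abcd]
    L2_mult_integrable[OF m(3) m(4), folded abcd] L2_mult_integrable[OF m(4) m(4), folded abcd]
  have vv: "set_integrable lborel (Om_o S) (\<lambda>x. (a x - b x) * (a x - b x))"
  proof -
    have "(\<lambda>x. (a x - b x) * (a x - b x)) = (\<lambda>x. a x * a x - 2 * (a x * b x) + b x * b x)"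
      by (auto simp: algebra_simps)
    then show ?thesis by (simp add: set_integral_add set_integral_diff)
  qed
  have vu: "set_integrable lborel (Om_o S) (\<lambda>x. (c x - d x) * (a x - b x))"
  proof -
    have "(\<lambda>x. (c x - d x) * (a x - b x)) = (\<lambda>x. a x * c x - b x * c x - a x * d x + b x * d x)"
      by (auto simp: algebra_simps)
    then show ?thesis by (simp add: set_integral_add set_integral_diff)
  qed
  have uu: "set_integrable lborel (Om_o S) (\<lambda>x. (c x - d x) * (c x - d x))"
  proof -
    have "(\<lambda>x. (c x - d x) * (c x - d x)) = (\<lambda>x. c x * c x - 2 * (c x * d x) + d x * d x)"
      by (auto simp: algebra_simps)
    then show ?thesis by (simp add: set_integral_add set_integral_diff)
  qed
  have e: "(\<lambda>x. ((a x + c x) - (b x + d x)) * ((a x + c x) - (b x + d x)))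
     = (\<lambda>x. (a x - b x) * (a x - b x) + (2 * ((c x - d x) * (a x - b x)) + (c x - d x) * (c x - d x)))"
    by (auto simp: algebra_simps)
  have sq: "(L2_norm D f)\<^sup>2 = L2_inner D f f" for D and f :: "'a \<Rightarrow> real"
    unfolding L2_norm_def L2_inner_def set_lebesgue_integral_def
    by (simp add: integral_nonneg_AE indicator_def)
  have "L2_inner (Om_o S) (\<lambda>x. (a x + c x) - (b x + d x)) (\<lambda>x. (a x + c x) - (b x + d x)) =
     L2_inner (Om_o S) (\<lambda>x. a x - b x) (\<lambda>x. a x - b x)
     + 2 * L2_inner (Om_o S) (\<lambda>x. c x - d x) (\<lambda>x. a x - b x)
     + L2_inner (Om_o S) (\<lambda>x. c x - d x) (\<lambda>x. c x - d x)"
    unfolding L2_inner_def e using vv vu uu by (simp add: set_integral_add)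
  then show ?thesis
    unfolding J_def Q_def F_def sq u_n_def[abs_def] u_l_def[abs_def] v_diff_def[abs_def] u0_diff_def[abs_def] abcd
    by (simp add: algebra_simps)
qed

text \<open>On the image of a control \<open>\<theta>\<close> this is \<open>J S \<theta>\<close>, by \<open>J_expansion\<close>.\<close>

definition J_ext ::
    "('a::euclidean_space) coupling \<Rightarrow> ('a control \<Rightarrow> 'h::banach) \<Rightarrow> 'h \<Rightarrow> real" where
  "J_ext S \<iota> \<theta> =
     (1/2) * Q_ext S \<iota> (\<theta>, \<theta>) - F_ext S \<iota> \<theta> + (1/2) * (L2_norm (Om_o S) (u0_diff S))\<^sup>2"

end

theory Submission
  imports Defs
begin

text \<open>
  The theorem is the Riesz representation theorem, or equally the quadratic case of the Lax-Milgram
  lemma, once two points are settled: that the completion is a Hilbert space whose inner product is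
  the extended form, and that the extended functional is bounded and linear there.

  Both rest on the linearity of the solution maps \<open>\<theta>\<^sub>n \<mapsto> v\<^sub>n(\<theta>\<^sub>n)\<close> and \<open>\<theta>\<^sub>l \<mapsto> v\<^sub>l(\<theta>\<^sub>l)\<close>. A linear
  combination of solutions solves the problem with the combined data, and unique solvability
  identifies it, almost everywhere, with the solution selected for these data. For the nonlocal problem
  this is because the energy is half the squared \<open>L\<^sup>2\<close> norm of
  \<open>(x, y) \<mapsto> (u y - u x) \<surd>\<gamma>(x, y)\<close> on the product domain, so that the weak form is an \<open>L\<^sup>2\<close> inner
  product, linear in \<open>u\<close>. For the local problem it is because weak gradients and traces,
  being defined by integral identities and by limits in quadratic mean, are compatible with linear
  combinations (\<open>weak_grad_lincomb\<close>, \<open>has_trace_lincomb\<close>). Hence the control space is a vector space on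
  which \<open>Q\<close> is bilinear and \<open>F\<close> linear (\<open>Theta_lincomb\<close>, \<open>Q_lincomb\<close>, \<open>F_lincomb\<close>).

  Let \<open>H\<close> be the completion. It is given only as a Banach space, but the norm of the image of a
  control is the energy norm, so polarization recovers \<open>Q\<close> from the norm of \<open>H\<close> on a dense set. As
  the polarized norm is continuous on all of \<open>H \<times> H\<close>, it is the extension of \<open>Q\<close>, and by
  density it is bilinear (\<open>polar_image\<close>, \<open>linear_polar\<close>, \<open>Q_ext_eq\<close>). The Cauchy-Schwarz inequality
  bounds \<open>F\<close> by a multiple of the energy norm; therefore \<open>F\<close> factors through a Lipschitz function on
  the image of the controls, which extends to a bounded linear functional on \<open>H\<close>
  (\<open>bounded_linear_F_ext\<close>).

  The minimizer comes from the parallelogram law: it makes every minimizing sequence of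
  \<open>q x x / 2 - l x\<close> a Cauchy sequence. Its limit \<open>s\<close> satisfies \<open>q s y = l y\<close> for all \<open>y\<close>, and then the
  functional at \<open>x\<close> exceeds its minimum by \<open>\<parallel>x - s\<parallel>\<^sup>2 / 2\<close>, which gives uniqueness
  (\<open>polar_form_minimizer\<close>).
\<close>

section \<open>Square integrable functions\<close>

lemma norm_lincomb_sq_le:
  fixes x y :: "'b::real_normed_vector"
  shows "(norm (a *\<^sub>R x + b *\<^sub>R y))\<^sup>2 \<le> 2 * a\<^sup>2 * (norm x)\<^sup>2 + 2 * b\<^sup>2 * (norm y)\<^sup>2"
proof -
  have "norm (a *\<^sub>R x + b *\<^sub>R y) \<le> \<bar>a\<bar> * norm x + \<bar>b\<bar> * norm y"
    using norm_triangle_ineq[of "a *\<^sub>R x" "b *\<^sub>R y"] by simp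
  then have "(norm (a *\<^sub>R x + b *\<^sub>R y))\<^sup>2 \<le> (\<bar>a\<bar> * norm x + \<bar>b\<bar> * norm y)\<^sup>2"
    by (intro power_mono) auto
  also have "\<dots> \<le> 2 * (\<bar>a\<bar> * norm x)\<^sup>2 + 2 * (\<bar>b\<bar> * norm y)\<^sup>2"
    using sum_squares_bound[of "\<bar>a\<bar> * norm x" "\<bar>b\<bar> * norm y"] by (simp add: power2_sum)
  finally show ?thesis by (simp add: power_mult_distrib)
qed

text \<open>The common source of all closure properties below: it gives both finiteness of norms of linear
  combinations and, with right-hand sides tending to zero, their convergence. The measure is
  arbitrary because it is used for Lebesgue measure and for surface measure.\<close>

lemma nn_integral_lincomb_sq_le:
  fixes f g :: "'a \<Rightarrow> 'b::euclidean_space"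
  assumes f: "set_borel_measurable M D f" and g: "set_borel_measurable M D g"
  shows "(\<integral>\<^sup>+x\<in>D. ennreal ((norm (a *\<^sub>R f x + b *\<^sub>R g x))\<^sup>2) \<partial>M)
    \<le> ennreal (2 * a\<^sup>2) * (\<integral>\<^sup>+x\<in>D. ennreal ((norm (f x))\<^sup>2) \<partial>M)
      + ennreal (2 * b\<^sup>2) * (\<integral>\<^sup>+x\<in>D. ennreal ((norm (g x))\<^sup>2) \<partial>M)"
proof -
  have [measurable]: "(\<lambda>x. indicator D x *\<^sub>R f x) \<in> borel_measurable M"
    "(\<lambda>x. indicator D x *\<^sub>R g x) \<in> borel_measurable M"
    using f g by (auto simp: set_borel_measurable_def)
  have e: "(\<integral>\<^sup>+x\<in>D. ennreal ((norm (h x))\<^sup>2) \<partial>M)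
      = (\<integral>\<^sup>+x. ennreal ((norm (indicator D x *\<^sub>R h x))\<^sup>2) \<partial>M)" for h :: "'a \<Rightarrow> 'b"
    by (intro nn_integral_cong) (auto simp: indicator_def)
  have "(\<integral>\<^sup>+x\<in>D. ennreal ((norm (a *\<^sub>R f x + b *\<^sub>R g x))\<^sup>2) \<partial>M)
    \<le> (\<integral>\<^sup>+x. ennreal (2 * a\<^sup>2) * ennreal ((norm (indicator D x *\<^sub>R f x))\<^sup>2)
         + ennreal (2 * b\<^sup>2) * ennreal ((norm (indicator D x *\<^sub>R g x))\<^sup>2) \<partial>M)"
    by (intro nn_integral_mono)
       (auto simp: indicator_def ennreal_mult[symmetric] ennreal_plus[symmetric]
             simp del: ennreal_plus intro!: ennreal_leI norm_lincomb_sq_le)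
  also have "\<dots> = ennreal (2 * a\<^sup>2) * (\<integral>\<^sup>+x\<in>D. ennreal ((norm (f x))\<^sup>2) \<partial>M)
      + ennreal (2 * b\<^sup>2) * (\<integral>\<^sup>+x\<in>D. ennreal ((norm (g x))\<^sup>2) \<partial>M)"
    unfolding e by (subst nn_integral_add) (measurable, simp add: nn_integral_cmult del: norm_scaleR)
  finally show ?thesis .
qed

lemma set_borel_measurable_lincomb:
  fixes f g :: "'a \<Rightarrow> 'b::euclidean_space"
  assumes "set_borel_measurable M D f" "set_borel_measurable M D g"
  shows "set_borel_measurable M D (\<lambda>x. a *\<^sub>R f x + b *\<^sub>R g x)"
proof -
  have [measurable]: "(\<lambda>x. indicator D x *\<^sub>R f x) \<in> borel_measurable M"
    "(\<lambda>x. indicator D x *\<^sub>R g x) \<in> borel_measurable M"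
    using assms by (auto simp: set_borel_measurable_def)
  have "(\<lambda>x. indicator D x *\<^sub>R (a *\<^sub>R f x + b *\<^sub>R g x))
      = (\<lambda>x. a *\<^sub>R (indicator D x *\<^sub>R f x) + b *\<^sub>R (indicator D x *\<^sub>R g x))"
    by (auto simp: algebra_simps)
  then show ?thesis unfolding set_borel_measurable_def by (simp only:) measurable
qed

lemma L2_lincomb:
  assumes "f \<in> L2 D" "g \<in> L2 D"
  shows "(\<lambda>x. a *\<^sub>R f x + b *\<^sub>R g x) \<in> L2 D"
proof -
  have "(\<integral>\<^sup>+x\<in>D. ennreal ((norm (a *\<^sub>R f x + b *\<^sub>R g x))\<^sup>2) \<partial>lborel) < \<infinity>"
    using assms by (intro le_less_trans[OF nn_integral_lincomb_sq_le])
      (auto simp: L2_def ennreal_mult_less_top)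
  then show ?thesis using assms set_borel_measurable_lincomb unfolding L2_def by blast
qed

lemma L2_component:
  assumes "f \<in> L2 D"
  shows "(\<lambda>x. f x \<bullet> b) \<in> L2 D"
proof -
  have [measurable]: "(\<lambda>x. indicator D x *\<^sub>R f x) \<in> borel_measurable lborel"
    using assms by (simp add: L2_def set_borel_measurable_def)
  have e: "(\<lambda>x. indicator D x *\<^sub>R (f x \<bullet> b)) = (\<lambda>x. (indicator D x *\<^sub>R f x) \<bullet> b)" by auto
  have "set_borel_measurable lborel D (\<lambda>x. f x \<bullet> b)" unfolding set_borel_measurable_def e by measurable
  moreover have "(\<integral>\<^sup>+x\<in>D. ennreal ((norm (f x \<bullet> b))\<^sup>2) \<partial>lborel)
      \<le> (\<integral>\<^sup>+x. ennreal ((norm b)\<^sup>2) * ennreal ((norm (indicator D x *\<^sub>R f x))\<^sup>2) \<partial>lborel)"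
  proof (intro nn_integral_mono)
    fix x
    have "\<bar>f x \<bullet> b\<bar>\<^sup>2 \<le> (norm (f x) * norm b)\<^sup>2" by (intro power_mono Cauchy_Schwarz_ineq2) simp
    then show "ennreal ((norm (f x \<bullet> b))\<^sup>2) * indicator D x
        \<le> ennreal ((norm b)\<^sup>2) * ennreal ((norm (indicator D x *\<^sub>R f x))\<^sup>2)"
      by (auto simp: indicator_def ennreal_mult[symmetric] power_mult_distrib mult.commute intro!: ennreal_leI)
  qed
  moreover have "\<dots> = ennreal ((norm b)\<^sup>2) * (\<integral>\<^sup>+x\<in>D. ennreal ((norm (f x))\<^sup>2) \<partial>lborel)"
    by (subst nn_integral_cmult)
      (measurable, auto intro!: nn_integral_cong arg_cong2[where f="(*)"] simp: indicator_def)
  moreover have "\<dots> < \<infinity>" using assms by (auto simp: L2_def ennreal_mult_less_top)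
  ultimately show ?thesis by (simp add: L2_def le_less_trans)
qed

lemma L2_scaleR_integrable:
  fixes f :: "'a::euclidean_space \<Rightarrow> real" and g :: "'a \<Rightarrow> 'b::euclidean_space"
  assumes "f \<in> L2 D" "g \<in> L2 D"
  shows "set_integrable lborel D (\<lambda>x. f x *\<^sub>R g x)"
proof -
  have "integrable lborel (\<lambda>x. \<Sum>b\<in>Basis. (indicator D x *\<^sub>R (f x * (g x \<bullet> b))) *\<^sub>R b)"
    using L2_mult_integrable[OF assms(1) L2_component[OF assms(2)]]
    by (intro Bochner_Integration.integrable_sum integrable_scaleR_left) (simp add: set_integrable_def)
  also have "(\<lambda>x. \<Sum>b\<in>Basis. (indicator D x *\<^sub>R (f x * (g x \<bullet> b))) *\<^sub>R b) = (\<lambda>x. indicator D x *\<^sub>R f x *\<^sub>R g x)"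
  proof
    fix x
    have "(\<Sum>b\<in>Basis. (indicator D x *\<^sub>R (f x * (g x \<bullet> b))) *\<^sub>R b)
        = (indicator D x * f x) *\<^sub>R (\<Sum>b\<in>Basis. (g x \<bullet> b) *\<^sub>R b)"
      by (simp add: scaleR_sum_right mult.assoc)
    then show "(\<Sum>b\<in>Basis. (indicator D x *\<^sub>R (f x * (g x \<bullet> b))) *\<^sub>R b) = indicator D x *\<^sub>R f x *\<^sub>R g x"
      by (simp add: euclidean_representation)
  qed
  finally show ?thesis by (simp add: set_integrable_def)
qed

lemma L2_dot_integrable:
  fixes f g :: "'a::euclidean_space \<Rightarrow> 'b::euclidean_space"
  assumes "f \<in> L2 D" "g \<in> L2 D"
  shows "set_integrable lborel D (\<lambda>x. f x \<bullet> g x)"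
  unfolding euclidean_inner[of "f _" "g _"] set_integrable_def scaleR_sum_right
  using L2_mult_integrable[OF L2_component[OF assms(1)] L2_component[OF assms(2)]]
  by (intro Bochner_Integration.integrable_sum) (simp add: set_integrable_def)

lemma set_integral_lincomb:
  fixes f g :: "'a \<Rightarrow> 'b::{banach, second_countable_topology}"
  assumes "set_integrable M D f" "set_integrable M D g"
  shows "(LINT x:D|M. a *\<^sub>R f x + b *\<^sub>R g x) = a *\<^sub>R (LINT x:D|M. f x) + b *\<^sub>R (LINT x:D|M. g x)"
  using assms by (simp add: set_integral_add set_integrable_scaleR_right)

lemma L2_inner_commute: "L2_inner D f g = L2_inner D g f"
  by (simp add: L2_inner_def mult.commute)

lemma L2_inner_lincomb:
  assumes "f \<in> L2 D" "g \<in> L2 D" "h \<in> L2 D"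
  shows "L2_inner D (\<lambda>x. a * f x + b * g x) h = a * L2_inner D f h + b * L2_inner D g h"
  using set_integral_lincomb[OF L2_mult_integrable[OF assms(1,3)] L2_mult_integrable[OF assms(2,3)]]
  by (simp add: L2_inner_def distrib_right mult.assoc)

lemma L2_inner_nonneg: "0 \<le> L2_inner D f f"
  unfolding L2_inner_def set_lebesgue_integral_def
  by (intro integral_nonneg_AE) (simp add: indicator_def)

lemma L2_norm_power2: "(L2_norm D f)\<^sup>2 = L2_inner D f f"
  by (simp add: L2_norm_def L2_inner_nonneg)

lemma L2_norm_lincomb_power2:
  assumes f: "f \<in> L2 D" and g: "g \<in> L2 D"
  shows "(L2_norm D (\<lambda>x. a * f x + b * g x))\<^sup>2
    = a\<^sup>2 * (L2_norm D f)\<^sup>2 + 2 * a * b * L2_inner D f g + b\<^sup>2 * (L2_norm D g)\<^sup>2"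
proof -
  have h: "(\<lambda>x. a * f x + b * g x) \<in> L2 D" using L2_lincomb[OF f g, of a b] by simp
  show ?thesis
    unfolding L2_norm_power2 L2_inner_lincomb[OF f g h] L2_inner_commute[of D _ "\<lambda>x. a * f x + b * g x"]
      L2_inner_lincomb[OF f g f] L2_inner_lincomb[OF f g g]
    by (simp add: L2_inner_commute[of D g f] power2_eq_square algebra_simps)
qed

text \<open>The quadratic form \<open>a\<^sup>2 A\<^sup>2 + 2 a b B + b\<^sup>2 C\<^sup>2\<close> of \<^const>\<open>L2_norm\<close> on the span of \<open>f\<close> and \<open>g\<close> is
  nonnegative, so its discriminant is not positive.\<close>

lemma L2_Cauchy_Schwarz:
  assumes f: "f \<in> L2 D" and g: "g \<in> L2 D"
  shows "\<bar>L2_inner D f g\<bar> \<le> L2_norm D f * L2_norm D g"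
proof -
  define A B C where ABC: "A = L2_norm D f" "B = L2_inner D f g" "C = L2_norm D g"
  have nn: "0 \<le> A" "0 \<le> C" by (simp_all add: ABC L2_norm_def L2_inner_nonneg)
  have ge: "0 \<le> a\<^sup>2 * A\<^sup>2 + 2 * a * b * B + b\<^sup>2 * C\<^sup>2" for a b
    unfolding ABC L2_norm_lincomb_power2[OF f g, symmetric] by simp
  have "B\<^sup>2 \<le> (A * C)\<^sup>2"
  proof (cases "C = 0")
    case True
    \<comment> \<open>For \<open>a = 1\<close> the form is then affine in \<open>b\<close>, and the chosen \<open>b\<close> would give it the value \<open>-1\<close>.\<close>
    have "B = 0"
    proof (rule ccontr)
      assume "B \<noteq> 0"
      have "0 \<le> A\<^sup>2 + 2 * (- (A\<^sup>2 + 1) / (2 * B)) * B" using ge[of 1 "- (A\<^sup>2 + 1) / (2 * B)"] True by simp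
      then show False using \<open>B \<noteq> 0\<close> by (simp add: field_simps)
    qed
    then show ?thesis by simp
  next
    case False
    have "0 \<le> C\<^sup>2 * ((A * C)\<^sup>2 - B\<^sup>2)" using ge[of "C\<^sup>2" "- B"] by (simp add: power2_eq_square algebra_simps)
    then show ?thesis using False by (simp add: zero_le_mult_iff)
  qed
  then have "\<bar>B\<bar> \<le> A * C" using nn by (metis abs_le_square_iff abs_of_nonneg mult_nonneg_nonneg)
  then show ?thesis by (simp add: ABC)
qed

section \<open>Weak gradients and traces\<close>

lemma frechet_derivative_lincomb:
  fixes f g :: "'a::euclidean_space \<Rightarrow> real"
  assumes "f differentiable (at x)" "g differentiable (at x)"
  shows "frechet_derivative (\<lambda>x. a * f x + b * g x) (at x)
    = (\<lambda>h. a * frechet_derivative f (at x) h + b * frechet_derivative g (at x) h)"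
proof -
  have "((\<lambda>x. a * f x + b * g x) has_derivative
      (\<lambda>h. a * frechet_derivative f (at x) h + b * frechet_derivative g (at x) h)) (at x)"
    using assms[unfolded frechet_derivative_works]
    by (intro has_derivative_add has_derivative_mult_right)
  then show ?thesis by (rule frechet_derivative_at[symmetric])
qed

lemma C_k_lincomb:
  assumes "C_k k f" "C_k k g"
  shows "C_k k (\<lambda>x. a * f x + b * g x)"
  using assms
proof (induction k arbitrary: f g)
  case 0
  then show ?case by (auto intro!: continuous_intros)
next
  case (Suc k)
  then have d: "f differentiable (at x)" "g differentiable (at x)" for x by auto
  show ?case
    using Suc by (auto simp: frechet_derivative_lincomb[OF d] intro!: derivative_intros)
qed

lemma C_inf_lincomb: "C_inf f \<Longrightarrow> C_inf g \<Longrightarrow> C_inf (\<lambda>x. a * f x + b * g x)"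
  by (simp add: C_inf_def C_k_lincomb)

lemma C_inf_differentiable:
  assumes "C_inf f"
  shows "f differentiable (at x)"
proof -
  have "C_k (Suc 0) f" using assms by (simp only: C_inf_def)
  then show ?thesis by simp
qed

lemma C_inf_continuous:
  assumes "C_inf f"
  shows "continuous_on UNIV f"
proof -
  have "C_k 0 f" using assms by (simp only: C_inf_def)
  then show ?thesis by simp
qed

lemma C_inf_continuous_grad:
  assumes "C_inf f"
  shows "continuous_on UNIV (grad f)"
proof -
  have "C_k (Suc 0) f" using assms by (simp only: C_inf_def)
  then show ?thesis unfolding grad_def[abs_def] by (intro continuous_intros) auto
qed

lemma grad_lincomb:
  assumes "C_inf f" "C_inf g"
  shows "grad (\<lambda>x. a * f x + b * g x) x = a *\<^sub>R grad f x + b *\<^sub>R grad g x"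
  unfolding grad_def
    frechet_derivative_lincomb[OF C_inf_differentiable[OF assms(1)] C_inf_differentiable[OF assms(2)]]
  by (simp add: scaleR_sum_right sum.distrib scaleR_add_left)

lemma continuous_set_borel_measurable:
  fixes f :: "'a::euclidean_space \<Rightarrow> 'b::euclidean_space"
  assumes "continuous_on UNIV f" "D \<in> sets borel"
  shows "set_borel_measurable borel D f"
proof -
  have [measurable]: "f \<in> borel_measurable borel" using assms(1) by (rule borel_measurable_continuous_onI)
  show ?thesis using assms(2) unfolding set_borel_measurable_def by measurable
qed

lemma continuous_compact_support_L2:
  fixes f :: "'a::euclidean_space \<Rightarrow> 'b::euclidean_space"
  assumes f: "continuous_on UNIV f" and K: "compact K" and z: "\<And>x. x \<notin> K \<Longrightarrow> f x = 0"
    and D: "D \<in> sets borel"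
  shows "f \<in> L2 D"
proof -
  have "compact (f ` K)" using f K by (intro compact_continuous_image) (auto intro: continuous_on_subset)
  then obtain B where "0 < B" and B: "\<And>x. x \<in> K \<Longrightarrow> norm (f x) \<le> B"
    using compact_imp_bounded bounded_pos by (metis imageI)
  have "(\<integral>\<^sup>+x\<in>D. ennreal ((norm (f x))\<^sup>2) \<partial>lborel) \<le> (\<integral>\<^sup>+x. ennreal (B\<^sup>2) * indicator K x \<partial>lborel)"
    using z B by (intro nn_integral_mono) (auto simp: indicator_def intro!: ennreal_leI power_mono)
  also have "\<dots> = ennreal (B\<^sup>2) * emeasure lborel K"
    using K by (intro nn_integral_cmult_indicator) (auto intro: compact_imp_closed borel_closed)
  also have "\<dots> < \<infinity>"
    using emeasure_lborel_cbox_finite emeasure_bounded_finite[OF compact_imp_bounded[OF K]]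
    by (simp add: ennreal_mult_less_top)
  finally show ?thesis
    using continuous_set_borel_measurable[OF f D] by (simp add: L2_def set_borel_measurable_def)
qed

text \<open>The gradient vanishes off the closed support, because there the function agrees with zero on an
  open set. Together with continuity and compactness this makes the integrals in \<^const>\<open>weak_grad\<close>
  converge, so that they may be added.\<close>

lemma test_function_L2:
  assumes \<phi>: "test_function U \<phi>" and D: "D \<in> sets borel"
  shows "\<phi> \<in> L2 D" "grad \<phi> \<in> L2 D"
proof -
  let ?K = "closure {x. \<phi> x \<noteq> 0}"
  have K: "compact ?K" and s: "C_inf \<phi>" using \<phi> by (auto simp: test_function_def)
  have z: "\<phi> x = 0" if "x \<notin> ?K" for x using that closure_subset[of "{x. \<phi> x \<noteq> 0}"] by blast
  have "grad \<phi> x = 0" if x: "x \<notin> ?K" for x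
  proof -
    have "frechet_derivative \<phi> (at x) = frechet_derivative (\<lambda>x. 0) (at x)"
    proof (rule frechet_derivative_transform_within_open)
      show "\<phi> differentiable (at x)" by (rule C_inf_differentiable[OF s])
      show "open (- ?K)" by (rule open_Compl[OF closed_closure])
      show "x \<in> - ?K" using x by blast
      show "\<phi> y = 0" if "y \<in> - ?K" for y using z[OF ComplD[OF that]] .
    qed
    then show ?thesis by (simp add: grad_def)
  qed
  then show "grad \<phi> \<in> L2 D"
    by (intro continuous_compact_support_L2[OF C_inf_continuous_grad[OF s] K _ D])
  show "\<phi> \<in> L2 D"
    by (rule continuous_compact_support_L2[OF C_inf_continuous[OF s] K z D])
qed

lemma L2_interior: "v \<in> L2 D \<Longrightarrow> v \<in> L2 (interior D)"
  by (rule L2_mono[of v D]) (simp_all add: interior_subset)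

lemma weak_grad_lincomb:
  assumes v: "v \<in> L2 D" "weak_grad D v G" and w: "w \<in> L2 D" "weak_grad D w H"
  shows "weak_grad D (\<lambda>x. a * v x + b * w x) (\<lambda>x. a *\<^sub>R G x + b *\<^sub>R H x)"
  unfolding weak_grad_def
proof (intro conjI allI impI)
  have GH: "G \<in> L2 (interior D)" "H \<in> L2 (interior D)" using v w by (auto simp: weak_grad_def)
  then show "(\<lambda>x. a *\<^sub>R G x + b *\<^sub>R H x) \<in> L2 (interior D)" by (rule L2_lincomb)
  fix \<phi> assume \<phi>: "test_function (interior D) \<phi>"
  note tf = test_function_L2[OF \<phi>, of "interior D", simplified]
  have "(LINT x:interior D|lborel. (a * v x + b * w x) *\<^sub>R grad \<phi> x)
      = a *\<^sub>R (LINT x:interior D|lborel. v x *\<^sub>R grad \<phi> x) + b *\<^sub>R (LINT x:interior D|lborel. w x *\<^sub>R grad \<phi> x)"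
    using set_integral_lincomb[OF L2_scaleR_integrable[OF L2_interior[OF v(1)] tf(2)]
        L2_scaleR_integrable[OF L2_interior[OF w(1)] tf(2)], of a b]
    by (simp add: algebra_simps)
  also have "\<dots> = - (a *\<^sub>R (LINT x:interior D|lborel. \<phi> x *\<^sub>R G x) + b *\<^sub>R (LINT x:interior D|lborel. \<phi> x *\<^sub>R H x))"
    using v(2) w(2) \<phi> by (simp add: weak_grad_def)
  also have "a *\<^sub>R (LINT x:interior D|lborel. \<phi> x *\<^sub>R G x) + b *\<^sub>R (LINT x:interior D|lborel. \<phi> x *\<^sub>R H x)
      = (LINT x:interior D|lborel. \<phi> x *\<^sub>R (a *\<^sub>R G x + b *\<^sub>R H x))"
    using set_integral_lincomb[OF L2_scaleR_integrable[OF tf(1) GH(1)]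
        L2_scaleR_integrable[OF tf(1) GH(2)], of a b]
    by (simp add: scaleR_add_right mult.commute)
  finally show "(LINT x:interior D|lborel. (a * v x + b * w x) *\<^sub>R grad \<phi> x)
      = - (LINT x:interior D|lborel. \<phi> x *\<^sub>R (a *\<^sub>R G x + b *\<^sub>R H x))" .
qed

lemma H1_lincomb:
  assumes "v \<in> H1 D" "w \<in> H1 D"
  shows "(\<lambda>x. a * v x + b * w x) \<in> H1 D"
  using assms weak_grad_lincomb L2_lincomb[of v D w a b] unfolding H1_def by fastforce

lemma sets_surface_measure: "sets surface_measure = sets borel"
  unfolding surface_measure_def using sets.sigma_sets_eq[of borel] by (simp add: sets_measure_of)

lemma set_borel_measurable_cong_sets:
  "sets M = sets N \<Longrightarrow> set_borel_measurable M D f = set_borel_measurable N D f"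
  by (simp add: set_borel_measurable_def cong: measurable_cong_sets)

lemma ennreal_tendsto_0_lincomb:
  fixes A B C :: "nat \<Rightarrow> ennreal"
  assumes "A \<longlonglongrightarrow> 0" "B \<longlonglongrightarrow> 0" "\<And>k. C k \<le> ennreal a * A k + ennreal b * B k"
  shows "C \<longlonglongrightarrow> 0"
proof -
  have "(\<lambda>k. ennreal a * A k + ennreal b * B k) \<longlonglongrightarrow> ennreal a * 0 + ennreal b * 0"
    by (intro tendsto_add ennreal_tendsto_cmult assms) auto
  then have "(\<lambda>k. ennreal a * A k + ennreal b * B k) \<longlonglongrightarrow> 0" by simp
  then show ?thesis
    by (rule tendsto_sandwich[OF _ _ tendsto_const, rotated 2]) (use assms(3) in auto)
qed

text \<open>If \<open>\<phi>\<^sub>k\<close> and \<open>\<psi>\<^sub>k\<close> are smooth approximations that define the two traces, then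
  \<open>a \<phi>\<^sub>k + b \<psi>\<^sub>k\<close> defines the trace of the linear combination: each of the three errors is at most
  \<open>2 a\<^sup>2\<close> times that of \<open>\<phi>\<^sub>k\<close> plus \<open>2 b\<^sup>2\<close> times that of \<open>\<psi>\<^sub>k\<close>.\<close>

lemma has_trace_lincomb:
  fixes v w :: "'a::euclidean_space \<Rightarrow> real"
  assumes D: "D \<in> sets borel" and v: "has_trace D v g" and w: "has_trace D w h"
  shows "has_trace D (\<lambda>x. a * v x + b * w x) (\<lambda>x. a * g x + b * h x)"
proof -
  from v obtain G \<phi> where vH: "v \<in> H1 D" and gm: "set_borel_measurable borel (frontier D) g"
    and G: "weak_grad D v G" and \<phi>: "\<And>k. C_inf (\<phi> k)"
    and \<phi>v: "(\<lambda>k::nat. (\<integral>\<^sup>+x\<in>D. ennreal ((\<phi> k x - v x)\<^sup>2) \<partial>lborel)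
            + (\<integral>\<^sup>+x\<in>interior D. ennreal ((norm (grad (\<phi> k) x - G x))\<^sup>2) \<partial>lborel)) \<longlonglongrightarrow> 0"
    and \<phi>g: "(\<lambda>k. \<integral>\<^sup>+x\<in>frontier D. ennreal ((\<phi> k x - g x)\<^sup>2) \<partial>surface_measure) \<longlonglongrightarrow> 0"
    unfolding has_trace_def by blast
  from w obtain H \<psi> where wH: "w \<in> H1 D" and hm: "set_borel_measurable borel (frontier D) h"
    and H: "weak_grad D w H" and \<psi>: "\<And>k. C_inf (\<psi> k)"
    and \<psi>w: "(\<lambda>k::nat. (\<integral>\<^sup>+x\<in>D. ennreal ((\<psi> k x - w x)\<^sup>2) \<partial>lborel)
            + (\<integral>\<^sup>+x\<in>interior D. ennreal ((norm (grad (\<psi> k) x - H x))\<^sup>2) \<partial>lborel)) \<longlonglongrightarrow> 0"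
    and \<psi>h: "(\<lambda>k. \<integral>\<^sup>+x\<in>frontier D. ennreal ((\<psi> k x - h x)\<^sup>2) \<partial>surface_measure) \<longlonglongrightarrow> 0"
    unfolding has_trace_def by blast
  have vw: "v \<in> L2 D" "w \<in> L2 D" using vH wH by (auto simp: H1_def)
  have diffm: "set_borel_measurable M X (\<lambda>x. f x - f' x)"
    if "set_borel_measurable M X f" "set_borel_measurable M X f'"
    for M X and f f' :: "'a \<Rightarrow> 'b::euclidean_space"
    using set_borel_measurable_lincomb[OF that, of 1 "-1"] by simp
  have lb: "sets (lborel :: 'a measure) = sets borel" by simp
  note cm = continuous_set_borel_measurable[OF C_inf_continuous]
    continuous_set_borel_measurable[OF C_inf_continuous_grad]
  have fr: "frontier D \<in> sets borel" by simp
  have m: "set_borel_measurable lborel D v" "set_borel_measurable lborel D w"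
    "set_borel_measurable lborel (interior D) G" "set_borel_measurable lborel (interior D) H"
    using vw G H by (auto simp: L2_def weak_grad_def)
  define \<zeta> where "\<zeta> k x = a * \<phi> k x + b * \<psi> k x" for k x
  have \<zeta>: "C_inf (\<zeta> k)" for k unfolding \<zeta>_def[abs_def] by (intro C_inf_lincomb \<phi> \<psi>)
  have l2: "(\<integral>\<^sup>+x\<in>D. ennreal ((\<zeta> k x - (a * v x + b * w x))\<^sup>2) \<partial>lborel)
    \<le> ennreal (2 * a\<^sup>2) * (\<integral>\<^sup>+x\<in>D. ennreal ((\<phi> k x - v x)\<^sup>2) \<partial>lborel)
      + ennreal (2 * b\<^sup>2) * (\<integral>\<^sup>+x\<in>D. ennreal ((\<psi> k x - w x)\<^sup>2) \<partial>lborel)" for k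
    using nn_integral_lincomb_sq_le[of lborel D "\<lambda>x. \<phi> k x - v x" "\<lambda>x. \<psi> k x - w x" a b,
      OF diffm diffm] cm(1)[OF \<phi> D] cm(1)[OF \<psi> D] m
    by (simp add: set_borel_measurable_cong_sets[OF lb] \<zeta>_def algebra_simps)
  have gr: "(\<integral>\<^sup>+x\<in>interior D. ennreal ((norm (grad (\<zeta> k) x - (a *\<^sub>R G x + b *\<^sub>R H x)))\<^sup>2) \<partial>lborel)
    \<le> ennreal (2 * a\<^sup>2) * (\<integral>\<^sup>+x\<in>interior D. ennreal ((norm (grad (\<phi> k) x - G x))\<^sup>2) \<partial>lborel)
      + ennreal (2 * b\<^sup>2) * (\<integral>\<^sup>+x\<in>interior D. ennreal ((norm (grad (\<psi> k) x - H x))\<^sup>2) \<partial>lborel)" for k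
    using nn_integral_lincomb_sq_le[of lborel "interior D" "\<lambda>x. grad (\<phi> k) x - G x"
        "\<lambda>x. grad (\<psi> k) x - H x" a b, OF diffm diffm]
      cm(2)[OF \<phi>, of "interior D"] cm(2)[OF \<psi>, of "interior D"] m
    by (simp add: set_borel_measurable_cong_sets[OF lb] \<zeta>_def[abs_def] grad_lincomb[OF \<phi> \<psi>] algebra_simps)
  have bd: "(\<integral>\<^sup>+x\<in>frontier D. ennreal ((\<zeta> k x - (a * g x + b * h x))\<^sup>2) \<partial>surface_measure)
    \<le> ennreal (2 * a\<^sup>2) * (\<integral>\<^sup>+x\<in>frontier D. ennreal ((\<phi> k x - g x)\<^sup>2) \<partial>surface_measure)
      + ennreal (2 * b\<^sup>2) * (\<integral>\<^sup>+x\<in>frontier D. ennreal ((\<psi> k x - h x)\<^sup>2) \<partial>surface_measure)" for k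
    using nn_integral_lincomb_sq_le[of surface_measure "frontier D" "\<lambda>x. \<phi> k x - g x"
        "\<lambda>x. \<psi> k x - h x" a b, OF diffm diffm] cm(1)[OF \<phi> fr] cm(1)[OF \<psi> fr] gm hm
    by (simp add: set_borel_measurable_cong_sets[OF sets_surface_measure] \<zeta>_def algebra_simps)
  show ?thesis
    unfolding has_trace_def
  proof (intro conjI exI allI)
    show "(\<lambda>x. a * v x + b * w x) \<in> H1 D" using vH wH by (rule H1_lincomb)
    show "set_borel_measurable borel (frontier D) (\<lambda>x. a * g x + b * h x)"
      using set_borel_measurable_lincomb[OF gm hm, of a b] by simp
    show "weak_grad D (\<lambda>x. a * v x + b * w x) (\<lambda>x. a *\<^sub>R G x + b *\<^sub>R H x)"
      using vw G H by (intro weak_grad_lincomb)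
    show "C_inf (\<zeta> k)" for k by (rule \<zeta>)
    show "(\<lambda>k. (\<integral>\<^sup>+x\<in>D. ennreal ((\<zeta> k x - (a * v x + b * w x))\<^sup>2) \<partial>lborel)
        + (\<integral>\<^sup>+x\<in>interior D. ennreal ((norm (grad (\<zeta> k) x - (a *\<^sub>R G x + b *\<^sub>R H x)))\<^sup>2) \<partial>lborel))
      \<longlonglongrightarrow> 0"
      by (rule ennreal_tendsto_0_lincomb[OF \<phi>v \<psi>w, of _ "2 * a\<^sup>2" "2 * b\<^sup>2"])
        (rule order_trans[OF add_mono[OF l2 gr]], simp add: algebra_simps)
    show "(\<lambda>k. \<integral>\<^sup>+x\<in>frontier D. ennreal ((\<zeta> k x - (a * g x + b * h x))\<^sup>2) \<partial>surface_measure) \<longlonglongrightarrow> 0"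
      by (rule ennreal_tendsto_0_lincomb[OF \<phi>g \<psi>h bd])
  qed
qed

lemma trace_eq_lincomb:
  assumes D: "D \<in> sets borel" and "trace_eq D \<tau> v \<theta>" "trace_eq D \<tau> w \<mu>"
  shows "trace_eq D \<tau> (\<lambda>x. a * v x + b * w x) (\<lambda>x. a * \<theta> x + b * \<mu> x)"
proof -
  obtain g h where g: "has_trace D v g" "AE x in surface_measure. x \<in> \<tau> \<longrightarrow> g x = \<theta> x"
    and h: "has_trace D w h" "AE x in surface_measure. x \<in> \<tau> \<longrightarrow> h x = \<mu> x"
    using assms(2,3) unfolding trace_eq_def by blast
  have "AE x in surface_measure. x \<in> \<tau> \<longrightarrow> a * g x + b * h x = a * \<theta> x + b * \<mu> x"
    using g(2) h(2) by eventually_elim auto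
  with has_trace_lincomb[OF D g(1) h(1)] show ?thesis unfolding trace_eq_def by blast
qed

lemma H1_van_lincomb:
  assumes "D \<in> sets borel" "v \<in> H1_van D \<tau>" "w \<in> H1_van D \<tau>"
  shows "(\<lambda>x. a * v x + b * w x) \<in> H1_van D \<tau>"
  using assms H1_lincomb trace_eq_lincomb[of D \<tau> v "\<lambda>x. 0" w "\<lambda>x. 0" a b] unfolding H1_van_def by auto

lemma loc_weak_lincomb:
  assumes v: "v \<in> L2 (Om_l S)" "loc_weak S (\<lambda>x. 0) v" and w: "w \<in> L2 (Om_l S)" "loc_weak S (\<lambda>x. 0) w"
  shows "loc_weak S (\<lambda>x. 0) (\<lambda>x. a * v x + b * w x)"
proof -
  let ?I = "interior (Om_l S)"
  obtain G H where G: "weak_grad (Om_l S) v G" and H: "weak_grad (Om_l S) w H"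
    and eq: "\<And>z Z. z \<in> H1_van (Om_l S) (Gamma_l S) \<Longrightarrow> weak_grad (Om_l S) z Z \<Longrightarrow>
         (LINT x:?I|lborel. G x \<bullet> Z x) = 0 \<and> (LINT x:?I|lborel. H x \<bullet> Z x) = 0"
    using v(2) w(2) unfolding loc_weak_def by (auto simp: set_lebesgue_integral_def)
  have "(LINT x:?I|lborel. (a *\<^sub>R G x + b *\<^sub>R H x) \<bullet> Z x) = (LINT x:Om_l S|lborel. 0 * z x)"
    if z: "z \<in> H1_van (Om_l S) (Gamma_l S)" "weak_grad (Om_l S) z Z" for z Z
  proof -
    have "G \<in> L2 ?I" "H \<in> L2 ?I" "Z \<in> L2 ?I" using G H z(2) by (auto simp: weak_grad_def)
    then have "(LINT x:?I|lborel. (a *\<^sub>R G x + b *\<^sub>R H x) \<bullet> Z x)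
        = a * (LINT x:?I|lborel. G x \<bullet> Z x) + b * (LINT x:?I|lborel. H x \<bullet> Z x)"
      using set_integral_lincomb[OF L2_dot_integrable[of G ?I Z] L2_dot_integrable[of H ?I Z], of a b]
      by (simp add: inner_add_left)
    then show ?thesis using eq[OF z] by (simp add: set_lebesgue_integral_def)
  qed
  then show ?thesis using weak_grad_lincomb[OF v(1) G w(1) H] unfolding loc_weak_def by blast
qed

section \<open>The nonlocal energy\<close>

text \<open>The square root splits the kernel evenly between the two factors of the energy form, which turns
  that form into an \<open>L\<^sup>2\<close> inner product over pairs of points.\<close>

definition pair_diff :: "('a::euclidean_space) coupling \<Rightarrow> ('a \<Rightarrow> real) \<Rightarrow> 'a \<times> 'a \<Rightarrow> real" where
  "pair_diff S u p = (u (snd p) - u (fst p)) * sqrt (kern S (fst p) (snd p))"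

lemma pair_diff_measurable:
  assumes k: "(\<lambda>(x, y). kern S x y) \<in> borel_measurable borel" and D: "D \<in> sets borel"
    and u: "u \<in> L2 D"
  shows "set_borel_measurable borel (D \<times> D) (pair_diff S u)"
proof -
  define w where "w x = indicator D x *\<^sub>R u x" for x
  have [measurable]: "w \<in> borel_measurable borel"
    using u by (simp add: L2_def set_borel_measurable_def w_def[abs_def])
  have [measurable]: "(\<lambda>p. kern S (fst p) (snd p)) \<in> borel_measurable (borel \<Otimes>\<^sub>M borel)"
    using k by (simp add: borel_prod case_prod_unfold)
  have [measurable]: "D \<in> sets borel" by (rule D)
  have "(\<lambda>p. indicator (D \<times> D) p *\<^sub>R pair_diff S u p)
      = (\<lambda>p. indicator D (fst p) * indicator D (snd p) * ((w (snd p) - w (fst p)) * sqrt (kern S (fst p) (snd p))))"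
    by (auto simp: indicator_def w_def pair_diff_def)
  moreover have "\<dots> \<in> borel_measurable (borel \<Otimes>\<^sub>M borel)" by measurable
  ultimately show ?thesis by (simp add: set_borel_measurable_def borel_prod)
qed

lemma nl_energy_eq_pair_diff:
  assumes k: "(\<lambda>(x, y). kern S x y) \<in> borel_measurable borel" "\<And>x y. kern S x y \<ge> 0"
    and D: "D \<in> sets borel" and u: "u \<in> L2 D"
  shows "nl_energy S D u = (\<integral>\<^sup>+p\<in>D \<times> D. ennreal ((norm (pair_diff S u p))\<^sup>2) \<partial>lborel) / 2"
proof -
  have [measurable]: "(\<lambda>p. indicator (D \<times> D) p *\<^sub>R pair_diff S u p) \<in> borel_measurable (lborel \<Otimes>\<^sub>M lborel)"
    using pair_diff_measurable[OF k(1) D u] by (simp add: set_borel_measurable_def lborel_prod)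
  have "(\<integral>\<^sup>+p\<in>D \<times> D. ennreal ((norm (pair_diff S u p))\<^sup>2) \<partial>lborel)
      = (\<integral>\<^sup>+p. ennreal ((indicator (D \<times> D) p *\<^sub>R pair_diff S u p)\<^sup>2) \<partial>(lborel \<Otimes>\<^sub>M lborel))"
    unfolding lborel_prod by (intro nn_integral_cong) (auto simp: indicator_def)
  also have "\<dots> = (\<integral>\<^sup>+x. (\<integral>\<^sup>+y. ennreal ((indicator (D \<times> D) (x, y) *\<^sub>R pair_diff S u (x, y))\<^sup>2) \<partial>lborel) \<partial>lborel)"
    by (rule lborel.nn_integral_fst[symmetric]) measurable
  also have "\<dots> = (\<integral>\<^sup>+x\<in>D. (\<integral>\<^sup>+y\<in>D. ennreal ((u y - u x)\<^sup>2 * kern S x y) \<partial>lborel) \<partial>lborel)"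
    using k(2) by (intro nn_integral_cong)
      (auto simp: indicator_def pair_diff_def power_mult_distrib intro!: nn_integral_cong)
  finally show ?thesis by (simp add: nl_energy_def)
qed

lemma V_iff_pair_diff:
  assumes k: "(\<lambda>(x, y). kern S x y) \<in> borel_measurable borel" "\<And>x y. kern S x y \<ge> 0"
    and D: "D \<in> sets borel"
  shows "u \<in> V S D \<longleftrightarrow> u \<in> L2 D \<and> pair_diff S u \<in> L2 (D \<times> D)"
proof -
  have "set_borel_measurable lborel (D \<times> D) (pair_diff S u)" if "u \<in> L2 D"
    using pair_diff_measurable[OF k(1) D that] by (simp add: set_borel_measurable_def)
  moreover have "(x / 2 < \<infinity>) \<longleftrightarrow> x < \<infinity>" for x :: ennreal
    by (simp add: ennreal_divide_eq_top_iff less_top[symmetric])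
  ultimately show ?thesis
    using nl_energy_eq_pair_diff[OF k D] by (auto simp: V_def L2_def)
qed

lemma pair_diff_lincomb:
  "pair_diff S (\<lambda>x. a * u x + b * v x) = (\<lambda>p. a * pair_diff S u p + b * pair_diff S v p)"
  by (auto simp: pair_diff_def algebra_simps)

lemma V_lincomb:
  assumes k: "(\<lambda>(x, y). kern S x y) \<in> borel_measurable borel" "\<And>x y. kern S x y \<ge> 0"
    and D: "D \<in> sets borel" and "u \<in> V S D" "v \<in> V S D"
  shows "(\<lambda>x. a * u x + b * v x) \<in> V S D"
  using assms(4,5) L2_lincomb[of u D v a b] L2_lincomb[of "pair_diff S u" "D \<times> D" "pair_diff S v" a b]
  unfolding V_iff_pair_diff[OF k D] pair_diff_lincomb by simp

lemma V_van_lincomb: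
  assumes k: "(\<lambda>(x, y). kern S x y) \<in> borel_measurable borel" "\<And>x y. kern S x y \<ge> 0"
    and D: "D \<in> sets borel" and u: "u \<in> V_van S D \<tau>" and v: "v \<in> V_van S D \<tau>"
  shows "(\<lambda>x. a * u x + b * v x) \<in> V_van S D \<tau>"
proof -
  have "AE x in lborel. x \<in> \<tau> \<longrightarrow> u x = 0" "AE x in lborel. x \<in> \<tau> \<longrightarrow> v x = 0"
    using u v by (simp_all add: V_van_def)
  then have "AE x in lborel. x \<in> \<tau> \<longrightarrow> a * u x + b * v x = 0" by eventually_elim simp
  with V_lincomb[OF k D, of u v a b] u v show ?thesis by (simp add: V_van_def)
qed

text \<open>For functions of finite energy the integrand is absolutely integrable over the product domain, so
  Fubini's theorem turns the iterated integral into a single one. Without this the iterated integral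
  would not be visibly additive in \<open>u\<close>.\<close>

lemma nl_form_eq_L2_inner:
  assumes k: "(\<lambda>(x, y). kern S x y) \<in> borel_measurable borel" "\<And>x y. kern S x y \<ge> 0"
    and D: "D \<in> sets borel" and u: "u \<in> V S D" and z: "z \<in> V S D"
  shows "(LINT x:D|lborel. (LINT y:D|lborel. (u y - u x) * (z y - z x) * kern S x y))
    = L2_inner (D \<times> D) (pair_diff S u) (pair_diff S z)"
proof -
  define h where "h p = indicator (D \<times> D) p *\<^sub>R (pair_diff S u p * pair_diff S z p)" for p
  have h: "integrable (lborel \<Otimes>\<^sub>M lborel) h"
    using L2_mult_integrable[of "pair_diff S u" "D \<times> D" "pair_diff S z"] u z
    by (simp add: V_iff_pair_diff[OF k D] set_integrable_def h_def[abs_def] lborel_prod)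
  have "L2_inner (D \<times> D) (pair_diff S u) (pair_diff S z) = (\<integral>p. h p \<partial>(lborel \<Otimes>\<^sub>M lborel))"
    by (simp add: L2_inner_def set_lebesgue_integral_def h_def lborel_prod)
  also have "\<dots> = (\<integral>x. (\<integral>y. h (x, y) \<partial>lborel) \<partial>lborel)"
    by (rule lborel_pair.integral_fst'[OF h, symmetric])
  also have "\<dots> = (LINT x:D|lborel. (LINT y:D|lborel. (u y - u x) * (z y - z x) * kern S x y))"
    unfolding set_lebesgue_integral_def
  proof (intro Bochner_Integration.integral_cong refl)
    fix x
    have "h (x, y) = indicator D x * (indicator D y * ((u y - u x) * (z y - z x) * kern S x y))" for y
      using k(2)[of x y] by (auto simp: h_def pair_diff_def indicator_def)
    then show "(\<integral>y. h (x, y) \<partial>lborel)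
        = indicator D x *\<^sub>R (\<integral>y. indicator D y *\<^sub>R ((u y - u x) * (z y - z x) * kern S x y) \<partial>lborel)"
      by simp
  qed
  finally show ?thesis by simp
qed

text \<open>The \<open>u\<close> satisfying the homogeneous equation are the orthogonal complement, for the form of
  \<open>nl_form_eq_L2_inner\<close>, of the functions that vanish on the interaction domain.\<close>

lemma nl_weak_lincomb:
  assumes k: "(\<lambda>(x, y). kern S x y) \<in> borel_measurable borel" "\<And>x y. kern S x y \<ge> 0"
    and D: "Om_n S \<in> sets borel"
    and u: "u \<in> V S (Om_n S)" "nl_weak S (\<lambda>x. 0) u" and v: "v \<in> V S (Om_n S)" "nl_weak S (\<lambda>x. 0) v"
  shows "nl_weak S (\<lambda>x. 0) (\<lambda>x. a * u x + b * v x)"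
proof -
  have orth: "L2_inner (Om_n S \<times> Om_n S) (pair_diff S w) (pair_diff S z) = 0"
    if "w \<in> V S (Om_n S)" "nl_weak S (\<lambda>x. 0) w" "z \<in> V_van S (Om_n S) (eta_n S)" for w z
    using that nl_form_eq_L2_inner[OF k D that(1), of z]
    by (simp add: nl_weak_def V_van_def set_lebesgue_integral_def)
  show ?thesis
    unfolding nl_weak_def
  proof
    fix z assume z: "z \<in> V_van S (Om_n S) (eta_n S)"
    then have zV: "z \<in> V S (Om_n S)" by (simp add: V_van_def)
    have "L2_inner (Om_n S \<times> Om_n S) (pair_diff S (\<lambda>x. a * u x + b * v x)) (pair_diff S z) = 0"
      unfolding pair_diff_lincomb
      using u(1) v(1) zV orth[OF u z] orth[OF v z]
      by (subst L2_inner_lincomb) (simp_all add: V_iff_pair_diff[OF k D])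
    then show "(LINT x:Om_n S|lborel. (LINT y:Om_n S|lborel.
          ((a * u y + b * v y) - (a * u x + b * v x)) * (z y - z x) * kern S x y))
        = (LINT x:om_n S|lborel. 0 * z x)"
      using nl_form_eq_L2_inner[OF k D V_lincomb[OF k D u(1) v(1), of a b] zV]
      by (simp add: set_lebesgue_integral_def)
  qed
qed

section \<open>Linear dependence of the states on the controls\<close>

lemma coupling_setting_kern:
  assumes "coupling_setting S"
  shows "(\<lambda>(x, y). kern S x y) \<in> borel_measurable borel" "\<And>x y. kern S x y \<ge> 0"
  using assms by (auto simp: coupling_setting_def)

lemma coupling_setting_borel:
  assumes "coupling_setting S"
  shows "Om_n S \<in> sets borel" "Om_l S \<in> sets borel" "Om_o S \<in> sets borel"
  using assms closed_nbhd[of "om_n S" "radius S"]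
  by (auto simp: coupling_setting_def Om_o_def Om_n_def eta_n_def)

lemma solves_vn_lincomb:
  assumes S: "coupling_setting S" and u: "solves_vn S \<theta> u" and v: "solves_vn S \<mu> v"
  shows "solves_vn S (\<lambda>x. a * \<theta> x + b * \<mu> x) (\<lambda>x. a * u x + b * v x)"
proof -
  note k = coupling_setting_kern[OF S] and D = coupling_setting_borel(1)[OF S]
  have uV: "u \<in> V_van S (Om_n S) (eta_D S)" "v \<in> V_van S (Om_n S) (eta_D S)"
    using u v by (simp_all add: solves_vn_def)
  have "AE x in lborel. x \<in> eta_c S \<longrightarrow> u x = \<theta> x" "AE x in lborel. x \<in> eta_c S \<longrightarrow> v x = \<mu> x"
    using u v by (simp_all add: solves_vn_def)
  then have "AE x in lborel. x \<in> eta_c S \<longrightarrow> a * u x + b * v x = a * \<theta> x + b * \<mu> x"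
    by eventually_elim simp
  moreover have "nl_weak S (\<lambda>x. 0) (\<lambda>x. a * u x + b * v x)"
    using u v uV by (intro nl_weak_lincomb[OF k D]) (simp_all add: solves_vn_def V_van_def)
  ultimately show ?thesis using V_van_lincomb[OF k D uV] by (simp add: solves_vn_def)
qed

lemma solves_vl_lincomb:
  assumes S: "coupling_setting S" and u: "solves_vl S \<theta> u" and v: "solves_vl S \<mu> v"
  shows "solves_vl S (\<lambda>x. a * \<theta> x + b * \<mu> x) (\<lambda>x. a * u x + b * v x)"
proof -
  note D = coupling_setting_borel(2)[OF S]
  have "u \<in> L2 (Om_l S)" "v \<in> L2 (Om_l S)" using u v by (auto simp: solves_vl_def H1_van_def H1_def)
  then show ?thesis
    using u v H1_van_lincomb[OF D] trace_eq_lincomb[OF D] loc_weak_lincomb unfolding solves_vl_def by blast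
qed

text \<open>Controls are restrictions of admissible functions, or of traces of such functions, so linear
  combinations of the admissible functions witness those of the controls.\<close>

lemma Theta_lincomb:
  assumes S: "coupling_setting S" and \<sigma>: "\<sigma> \<in> Theta S" and \<mu>: "\<mu> \<in> Theta S"
  shows "lincomb a \<sigma> b \<mu> \<in> Theta S"
proof -
  have restr: "(\<lambda>x. a * restr X f x + b * restr X g x) = restr X (\<lambda>x. a * f x + b * g x)"
    for X :: "'a set" and f g by (auto simp: restr_def)
  obtain f g where n: "fst \<sigma> = restr (eta_c S) f" "f \<in> V_van S (Om_n S) (eta_D S)"
    "fst \<mu> = restr (eta_c S) g" "g \<in> V_van S (Om_n S) (eta_D S)"
    using \<sigma> \<mu> by (auto simp: Theta_def Theta_n_def)
  obtain g1 v1 g2 v2 where l: "snd \<sigma> = restr (Gamma_c S) g1" "v1 \<in> H1_van (Om_l S) (Gamma_D S)"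
    "has_trace (Om_l S) v1 g1"
    "snd \<mu> = restr (Gamma_c S) g2" "v2 \<in> H1_van (Om_l S) (Gamma_D S)" "has_trace (Om_l S) v2 g2"
    using \<sigma> \<mu> by (auto simp: Theta_def Theta_l_def)
  have "(\<lambda>x. a * fst \<sigma> x + b * fst \<mu> x) \<in> Theta_n S"
    unfolding n(1,3) restr Theta_n_def
    by (intro imageI V_van_lincomb coupling_setting_kern[OF S] coupling_setting_borel[OF S] n(2,4))
  moreover have "(\<lambda>x. a * snd \<sigma> x + b * snd \<mu> x) \<in> Theta_l S"
    unfolding l(1,4) restr Theta_l_def
    using H1_van_lincomb[OF coupling_setting_borel(2)[OF S] l(2,5), of a b]
      has_trace_lincomb[OF coupling_setting_borel(2)[OF S] l(3,6), of a b] by blast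
  ultimately show ?thesis by (simp add: Theta_def lincomb_def)
qed

lemma state_solutions:
  assumes S: "uniquely_solvable S"
  shows "\<sigma> \<in> Theta S \<Longrightarrow> solves_vn S (fst \<sigma>) (v_n S (fst \<sigma>))"
    and "\<sigma> \<in> Theta S \<Longrightarrow> solves_vl S (snd \<sigma>) (v_l S (snd \<sigma>))"
    and "solves_un0 S (u_n0 S)" and "solves_ul0 S (u_l0 S)"
  using S unfolding v_n_def v_l_def u_n0_def u_l0_def uniquely_solvable_def unique_ae_def Theta_def
  by (auto simp only: mem_Times_iff intro!: someI_ex[of "solves_vn S (fst \<sigma>)"]
      someI_ex[of "solves_vl S (snd \<sigma>)"] someI_ex[of "solves_un0 S"] someI_ex[of "solves_ul0 S"])

lemma L2_overlap_diff:
  assumes S: "coupling_setting S" and f: "f \<in> L2 (Om_n S)" and g: "g \<in> L2 (Om_l S)"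
  shows "(\<lambda>x. f x - g x) \<in> L2 (Om_o S)"
proof -
  have "f \<in> L2 (Om_o S)" "g \<in> L2 (Om_o S)"
    using L2_mono[OF f _ coupling_setting_borel(3)[OF S]] L2_mono[OF g _ coupling_setting_borel(3)[OF S]]
    by (auto simp: Om_o_def)
  from L2_lincomb[OF this, of 1 "-1"] show ?thesis by simp
qed

lemma v_diff_L2:
  assumes S: "coupling_setting S" "uniquely_solvable S" and \<sigma>: "\<sigma> \<in> Theta S"
  shows "v_diff S \<sigma> \<in> L2 (Om_o S)"
  unfolding v_diff_def[abs_def]
  using state_solutions(1,2)[OF S(2) \<sigma>] by (intro L2_overlap_diff[OF S(1)])
    (auto simp: solves_vn_def solves_vl_def V_van_def V_def H1_van_def H1_def)

lemma u0_diff_L2: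
  assumes S: "coupling_setting S" "uniquely_solvable S"
  shows "u0_diff S \<in> L2 (Om_o S)"
  unfolding u0_diff_def[abs_def]
  using state_solutions(3,4)[OF S(2)] by (intro L2_overlap_diff[OF S(1)])
    (auto simp: solves_un0_def solves_ul0_def V_van_def V_def H1_van_def H1_def)

text \<open>The states are selected by a choice operator, so that nothing relates the selections for different
  controls except uniqueness; hence the identity holds only almost everywhere, and on the overlap
  only, where both subdomain problems determine their solutions.\<close>

lemma v_diff_lincomb:
  assumes S: "coupling_setting S" "uniquely_solvable S" and \<sigma>: "\<sigma> \<in> Theta S" and \<mu>: "\<mu> \<in> Theta S"
  shows "AE x in lborel. x \<in> Om_o S \<longrightarrow> v_diff S (lincomb a \<sigma> b \<mu>) x = a * v_diff S \<sigma> x + b * v_diff S \<mu> x"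
proof -
  let ?\<rho> = "lincomb a \<sigma> b \<mu>"
  have \<rho>: "?\<rho> \<in> Theta S" by (rule Theta_lincomb[OF S(1) \<sigma> \<mu>])
  have "solves_vn S (fst ?\<rho>) (\<lambda>x. a * v_n S (fst \<sigma>) x + b * v_n S (fst \<mu>) x)"
    using solves_vn_lincomb[OF S(1) state_solutions(1)[OF S(2) \<sigma>] state_solutions(1)[OF S(2) \<mu>]]
    by (simp add: lincomb_def)
  then have n: "AE x in lborel. x \<in> Om_n S \<longrightarrow>
      v_n S (fst ?\<rho>) x = a * v_n S (fst \<sigma>) x + b * v_n S (fst \<mu>) x"
    using S(2) \<rho> state_solutions(1)[OF S(2) \<rho>] unfolding uniquely_solvable_def unique_ae_def Theta_def
    by (auto simp only: mem_Times_iff)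
  have "solves_vl S (snd ?\<rho>) (\<lambda>x. a * v_l S (snd \<sigma>) x + b * v_l S (snd \<mu>) x)"
    using solves_vl_lincomb[OF S(1) state_solutions(2)[OF S(2) \<sigma>] state_solutions(2)[OF S(2) \<mu>]]
    by (simp add: lincomb_def)
  then have l: "AE x in lborel. x \<in> Om_l S \<longrightarrow>
      v_l S (snd ?\<rho>) x = a * v_l S (snd \<sigma>) x + b * v_l S (snd \<mu>) x"
    using S(2) \<rho> state_solutions(2)[OF S(2) \<rho>] unfolding uniquely_solvable_def unique_ae_def Theta_def
    by (auto simp only: mem_Times_iff)
  show ?thesis
    using n l by eventually_elim (auto simp: v_diff_def Om_o_def algebra_simps)
qed

lemma L2_inner_cong_AE:
  assumes "AE x in lborel. x \<in> D \<longrightarrow> f x = f' x" "f \<in> L2 D" "f' \<in> L2 D" "g \<in> L2 D"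
  shows "L2_inner D f g = L2_inner D f' g"
  unfolding L2_inner_def set_lebesgue_integral_def
proof (rule integral_cong_AE)
  show "(\<lambda>x. indicator D x *\<^sub>R (f x * g x)) \<in> borel_measurable lborel"
    "(\<lambda>x. indicator D x *\<^sub>R (f' x * g x)) \<in> borel_measurable lborel"
    using L2_mult_integrable[OF assms(2,4)] L2_mult_integrable[OF assms(3,4)]
    unfolding set_integrable_def by (auto dest: borel_measurable_integrable)
  show "AE x in lborel. indicator D x *\<^sub>R (f x * g x) = indicator D x *\<^sub>R (f' x * g x)"
    using assms(1) by eventually_elim (auto simp: indicator_def)
qed

lemma Q_commute: "Q S \<sigma> \<mu> = Q S \<mu> \<sigma>"
  by (simp add: Q_def L2_inner_commute)

lemma L2_inner_v_diff_lincomb: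
  assumes S: "coupling_setting S" "uniquely_solvable S" and \<sigma>: "\<sigma> \<in> Theta S" and \<mu>: "\<mu> \<in> Theta S"
    and g: "g \<in> L2 (Om_o S)"
  shows "L2_inner (Om_o S) (v_diff S (lincomb a \<sigma> b \<mu>)) g
    = a * L2_inner (Om_o S) (v_diff S \<sigma>) g + b * L2_inner (Om_o S) (v_diff S \<mu>) g"
proof -
  note m = v_diff_L2[OF S \<sigma>] v_diff_L2[OF S \<mu>]
  have "(\<lambda>x. a * v_diff S \<sigma> x + b * v_diff S \<mu> x) \<in> L2 (Om_o S)" using L2_lincomb[OF m, of a b] by simp
  then have "L2_inner (Om_o S) (v_diff S (lincomb a \<sigma> b \<mu>)) g
      = L2_inner (Om_o S) (\<lambda>x. a * v_diff S \<sigma> x + b * v_diff S \<mu> x) g"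
    by (intro L2_inner_cong_AE v_diff_lincomb[OF S \<sigma> \<mu>] v_diff_L2[OF S] Theta_lincomb[OF S(1) \<sigma> \<mu>] g)
  also have "\<dots> = a * L2_inner (Om_o S) (v_diff S \<sigma>) g + b * L2_inner (Om_o S) (v_diff S \<mu>) g"
    by (rule L2_inner_lincomb[OF m g])
  finally show ?thesis .
qed

lemma Q_lincomb:
  assumes S: "coupling_setting S" "uniquely_solvable S"
    and "\<sigma> \<in> Theta S" "\<mu> \<in> Theta S" "\<tau> \<in> Theta S"
  shows "Q S (lincomb a \<sigma> b \<mu>) \<tau> = a * Q S \<sigma> \<tau> + b * Q S \<mu> \<tau>"
  unfolding Q_def by (intro L2_inner_v_diff_lincomb[OF S] v_diff_L2[OF S] assms)

lemma F_lincomb: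
  assumes S: "coupling_setting S" "uniquely_solvable S" and "\<sigma> \<in> Theta S" "\<mu> \<in> Theta S"
  shows "F S (lincomb a \<sigma> b \<mu>) = a * F S \<sigma> + b * F S \<mu>"
  unfolding F_def L2_inner_commute[of _ "u0_diff S"]
  by (simp add: L2_inner_v_diff_lincomb[OF S assms(3,4) u0_diff_L2[OF S]])

lemma energy_norm_power2: "(energy_norm S \<sigma>)\<^sup>2 = Q S \<sigma> \<sigma>"
  by (simp add: energy_norm_def Q_def L2_norm_power2)

text \<open>This is the continuity of \<^const>\<open>F\<close> in the energy norm, which makes its extension to the
  completion possible.\<close>

lemma F_bounded:
  assumes S: "coupling_setting S" "uniquely_solvable S" and "\<sigma> \<in> Theta S"
  shows "\<bar>F S \<sigma>\<bar> \<le> L2_norm (Om_o S) (u0_diff S) * energy_norm S \<sigma>"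
  using L2_Cauchy_Schwarz[OF u0_diff_L2[OF S] v_diff_L2[OF S assms(3)]]
  by (simp add: F_def energy_norm_def)

section \<open>Minimization of quadratic functionals in a Hilbert space\<close>

text \<open>The Riesz representation theorem for a Banach space whose norm comes from the bilinear form \<open>q\<close>,
  together with its variational meaning. Any two points satisfy
  \<open>\<parallel>x - y\<parallel>\<^sup>2 = 4 (j x + j y - 2 j ((x + y) / 2))\<close> for \<open>j x = q x x / 2 - l x\<close>, so points at which \<open>j\<close> is
  within \<open>\<epsilon>\<close> of its infimum are at squared distance at most \<open>8 \<epsilon>\<close>.\<close>

lemma polar_form_minimizer:
  fixes q :: "'h::banach \<Rightarrow> 'h \<Rightarrow> real" and l :: "'h \<Rightarrow> real"
  assumes lin: "\<And>z. linear (\<lambda>x. q x z)" and sym: "\<And>x y. q x y = q y x"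
    and sq: "\<And>x. q x x = (norm x)\<^sup>2" and l: "bounded_linear l"
  shows "\<exists>s. (\<forall>y. q s s / 2 - l s \<le> q y y / 2 - l y) \<and>
             (\<forall>s'. (\<forall>y. q s' s' / 2 - l s' \<le> q y y / 2 - l y) \<longrightarrow> s' = s) \<and>
             (\<forall>y. q s y = l y)"
proof -
  interpret l: bounded_linear l by (rule l)
  define j where "j x = q x x / 2 - l x" for x
  have j_eq: "j x = (norm x)\<^sup>2 / 2 - l x" for x by (simp add: j_def sq)
  have add: "q (x + y) z = q x z + q y z" for x y z using linear_add[OF lin] .
  have scale: "q (t *\<^sub>R x) z = t * q x z" for t x z using linear_scale[OF lin] by simp
  have diff: "q (x - y) z = q x z - q y z" for x y z using linear_diff[OF lin] .
  have add2: "q z (x + y) = q z x + q z y" for x y z using add sym by metis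
  have scale2: "q z (t *\<^sub>R x) = t * q z x" for t x z using scale sym by metis
  have diff2: "q z (x - y) = q z x - q z y" for x y z using diff sym by metis
  \<comment> \<open>The parallelogram law, in the form that makes near-minimizers close to each other.\<close>
  have mid: "(norm (x - y))\<^sup>2 = 4 * (j x + j y - 2 * j ((1/2) *\<^sub>R (x + y)))" for x y
    unfolding j_def sq[symmetric] add add2 scale scale2 diff diff2 l.add l.scaleR l.diff
    using sym[of x y] by (simp add: field_simps)
  obtain C where C: "\<And>x. norm (l x) \<le> norm x * C" using l.bounded by blast
  have "- (C\<^sup>2 / 2) \<le> j x" for x
  proof -
    have "0 \<le> (norm x - C)\<^sup>2" by simp
    then show ?thesis using C[of x] unfolding j_eq power2_diff
      by (simp add: abs_le_iff)
  qed
  then have bdd: "bdd_below (range j)" by (intro bdd_belowI2)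
  define m where "m = Inf (range j)"
  have m_le: "m \<le> j x" for x unfolding m_def using bdd by (intro cInf_lower) auto
  have "\<exists>x. j x < m + inverse (real (Suc n))" for n
    using cInf_lessD[of "range j" "m + inverse (real (Suc n))"] by (auto simp: m_def[symmetric])
  then obtain X where X: "\<And>n. j (X n) < m + inverse (real (Suc n))" by metis
  have close: "(norm (X i - X k))\<^sup>2 \<le> 8 * inverse (real (Suc n))" if "n \<le> i" "n \<le> k" for i k n
  proof -
    have "inverse (real (Suc i)) \<le> inverse (real (Suc n))" "inverse (real (Suc k)) \<le> inverse (real (Suc n))"
      using that by (auto intro: le_imp_inverse_le)
    then show ?thesis
      using X[of i] X[of k] m_le[of "(1/2) *\<^sub>R (X i + X k)"] unfolding mid by argo
  qed
  have "Cauchy X"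
  proof (rule metric_CauchyI)
    fix e :: real assume e: "0 < e"
    then have "0 < e\<^sup>2 / 8" by simp
    then obtain n where n: "inverse (real (Suc n)) < e\<^sup>2 / 8" using reals_Archimedean by blast
    have "dist (X i) (X k) < e" if "n \<le> i" "n \<le> k" for i k
    proof -
      have "(norm (X i - X k))\<^sup>2 < e\<^sup>2" using close[OF that] n by argo
      then show ?thesis using e by (simp add: dist_norm power_less_imp_less_base)
    qed
    then show "\<exists>M. \<forall>m\<ge>M. \<forall>n\<ge>M. dist (X m) (X n) < e" by blast
  qed
  then obtain s where s: "X \<longlonglongrightarrow> s" using Cauchy_convergent convergent_def by blast
  have "(\<lambda>n. j (X n)) \<longlonglongrightarrow> j s" unfolding j_eq by (intro tendsto_intros s l.tendsto) simp
  moreover have "(\<lambda>n. m + inverse (real (Suc n))) \<longlonglongrightarrow> m + 0"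
    by (intro tendsto_add tendsto_const LIMSEQ_inverse_real_of_nat)
  ultimately have "j s \<le> m + 0" by (rule LIMSEQ_le) (use X in \<open>auto intro: less_imp_le\<close>)
  then have min: "j s \<le> j y" for y using m_le[of y] by linarith
  have expand: "j (s + t *\<^sub>R y) = j s + t * (q s y - l y) + t\<^sup>2 * (norm y)\<^sup>2 / 2" for t y
    unfolding j_def sq[symmetric] add add2 scale scale2 l.add l.scaleR
    using sym[of s y] by (simp add: field_simps power2_eq_square)
  have var: "q s y = l y" for y
  proof (rule ccontr)
    assume "q s y \<noteq> l y"
    define d where "d = q s y - l y"
    have d: "d \<noteq> 0" using \<open>q s y \<noteq> l y\<close> by (simp add: d_def)
    \<comment> \<open>A step against the derivative \<open>d\<close>, short enough for the quadratic term not to make up for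
      the gain.\<close>
    define t where "t = - d / (1 + (norm y)\<^sup>2)"
    have p: "1 + (norm y)\<^sup>2 > 0" by (smt (verit) zero_le_power2)
    have td: "t * (1 + (norm y)\<^sup>2) = - d" using p by (simp add: t_def)
    have "0 \<le> t * d + t\<^sup>2 * (norm y)\<^sup>2 / 2" using min[of "s + t *\<^sub>R y"] expand[of t y] by (simp add: d_def)
    also have "t\<^sup>2 * (norm y)\<^sup>2 = t * (t * (1 + (norm y)\<^sup>2)) - t\<^sup>2" by (simp add: power2_eq_square algebra_simps)
    also have "\<dots> = - t * d - t\<^sup>2" unfolding td by simp
    finally have "0 \<le> t * d - t\<^sup>2" by argo
    moreover have "t * d = - d\<^sup>2 / (1 + (norm y)\<^sup>2)" by (simp add: t_def power2_eq_square)
    moreover have "- d\<^sup>2 / (1 + (norm y)\<^sup>2) < 0" using d p by (simp add: divide_neg_pos)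
    ultimately show False by (smt (verit) zero_le_power2)
  qed
  have "s' = s" if "\<forall>y. j s' \<le> j y" for s'
  proof -
    have "j s' = j s + (norm (s' - s))\<^sup>2 / 2" using expand[of 1 "s' - s"] var by simp
    then have "(norm (s' - s))\<^sup>2 \<le> 0" using that by (smt (verit) min field_sum_of_halves)
    then show ?thesis by simp
  qed
  with min var show ?thesis unfolding j_def by blast
qed

section \<open>Extension to the completion\<close>

text \<open>The polarized norm. It makes sense, and is continuous, in every normed space; it is an inner product
  exactly when the norm satisfies the parallelogram law.\<close>

definition polar :: "'h::real_normed_vector \<Rightarrow> 'h \<Rightarrow> real" where
  "polar x y = ((norm (x + y))\<^sup>2 - (norm (x - y))\<^sup>2) / 4"

lemma polar_self: "polar x x = (norm x)\<^sup>2"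
proof -
  have "norm (x + x) = 2 * norm x" by (simp add: scaleR_2[symmetric])
  then show ?thesis by (simp add: polar_def power_mult_distrib)
qed

lemma polar_commute: "polar x y = polar y x"
  by (simp add: polar_def add.commute norm_minus_commute)

lemma tendsto_polar:
  "(f \<longlongrightarrow> x) G \<Longrightarrow> (g \<longlongrightarrow> y) G \<Longrightarrow> ((\<lambda>n. polar (f n) (g n)) \<longlongrightarrow> polar x y) G"
  unfolding polar_def by (intro tendsto_intros) auto

lemma continuous_eq_on_dense:
  fixes f g :: "'a::topological_space \<Rightarrow> 'b::t2_space"
  assumes "continuous_on UNIV f" "continuous_on UNIV g" "closure A = UNIV" "\<And>x. x \<in> A \<Longrightarrow> f x = g x"
  shows "f = g"
proof -
  have "closed {x. f x = g x}" using assms(1,2) by (rule closed_Collect_eq)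
  then have "closure A \<subseteq> {x. f x = g x}" using assms(4) by (intro closure_minimal) auto
  then show ?thesis using assms(3) by auto
qed

context
  fixes S :: "('a::euclidean_space) coupling" and \<iota> :: "'a control \<Rightarrow> 'h::banach"
  assumes S: "coupling_setting S" "uniquely_solvable S" and \<iota>: "is_completion S \<iota>"
begin

lemma image_lincomb: "\<sigma> \<in> Theta S \<Longrightarrow> \<mu> \<in> Theta S \<Longrightarrow> \<iota> (lincomb a \<sigma> b \<mu>) = a *\<^sub>R \<iota> \<sigma> + b *\<^sub>R \<iota> \<mu>"
  using \<iota> by (simp add: is_completion_def)

lemma norm_image: "\<sigma> \<in> Theta S \<Longrightarrow> norm (\<iota> \<sigma>) = energy_norm S \<sigma>"
  using \<iota> by (simp add: is_completion_def)

lemma dense_image: "closure (\<iota> ` Theta S) = UNIV"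
  using \<iota> by (simp add: is_completion_def)

lemma approx_by_controls:
  obtains \<sigma> where "\<And>n. \<sigma> n \<in> Theta S" "(\<lambda>n. \<iota> (\<sigma> n)) \<longlonglongrightarrow> x"
proof -
  have "x \<in> closure (\<iota> ` Theta S)" by (simp add: dense_image)
  then obtain y where y: "\<And>n. y n \<in> \<iota> ` Theta S" "y \<longlonglongrightarrow> x" unfolding closure_sequential by blast
  then have "\<forall>n. \<exists>\<sigma>. \<sigma> \<in> Theta S \<and> y n = \<iota> \<sigma>" by blast
  then obtain \<sigma> where "\<And>n. \<sigma> n \<in> Theta S" "\<And>n. y n = \<iota> (\<sigma> n)" by metis
  moreover from this have "y = (\<lambda>n. \<iota> (\<sigma> n))" by auto
  ultimately show ?thesis using y(2) by (intro that[of \<sigma>]) auto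
qed

text \<open>The norm of \<open>a \<iota>(\<sigma>) + b \<iota>(\<mu>)\<close> is the energy norm of the combined control, whose square expands
  by bilinearity of \<^const>\<open>Q\<close>. The cases \<open>b = 1\<close> and \<open>b = -1\<close> give the claim.\<close>

lemma polar_image:
  assumes "\<sigma> \<in> Theta S" "\<mu> \<in> Theta S"
  shows "polar (\<iota> \<sigma>) (\<iota> \<mu>) = Q S \<sigma> \<mu>"
proof -
  have "(norm (a *\<^sub>R \<iota> \<sigma> + b *\<^sub>R \<iota> \<mu>))\<^sup>2
      = a\<^sup>2 * Q S \<sigma> \<sigma> + 2 * a * b * Q S \<sigma> \<mu> + b\<^sup>2 * Q S \<mu> \<mu>" for a b
  proof -
    have l: "lincomb a \<sigma> b \<mu> \<in> Theta S" by (rule Theta_lincomb[OF S(1) assms])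
    have "(norm (a *\<^sub>R \<iota> \<sigma> + b *\<^sub>R \<iota> \<mu>))\<^sup>2 = Q S (lincomb a \<sigma> b \<mu>) (lincomb a \<sigma> b \<mu>)"
      by (simp add: image_lincomb[OF assms, symmetric] norm_image[OF l] energy_norm_power2)
    also have "\<dots> = a * (a * Q S \<sigma> \<sigma> + b * Q S \<mu> \<sigma>) + b * (a * Q S \<sigma> \<mu> + b * Q S \<mu> \<mu>)"
      unfolding Q_lincomb[OF S assms l] Q_commute[of S \<sigma> "lincomb a \<sigma> b \<mu>"]
        Q_commute[of S \<mu> "lincomb a \<sigma> b \<mu>"] Q_lincomb[OF S assms assms(1)]
        Q_lincomb[OF S assms assms(2)] ..
    finally show ?thesis by (simp add: Q_commute[of S \<mu> \<sigma>] power2_eq_square algebra_simps)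
  qed
  from this[of 1 1] this[of 1 "-1"] show ?thesis by (simp add: polar_def)
qed

text \<open>On images of controls this is bilinearity of \<^const>\<open>Q\<close>; it passes to limits by continuity.\<close>

lemma linear_polar: "linear (\<lambda>x::'h. polar x z)"
proof -
  have *: "polar (a *\<^sub>R x + b *\<^sub>R y) z = a * polar x z + b * polar y z" for a b and x y :: 'h
  proof -
    obtain s t r where s: "\<And>n. s n \<in> Theta S" "(\<lambda>n. \<iota> (s n)) \<longlonglongrightarrow> x"
      and t: "\<And>n. t n \<in> Theta S" "(\<lambda>n. \<iota> (t n)) \<longlonglongrightarrow> y"
      and r: "\<And>n. r n \<in> Theta S" "(\<lambda>n. \<iota> (r n)) \<longlonglongrightarrow> z"
      using approx_by_controls by metis
    have "(\<lambda>n. polar (a *\<^sub>R \<iota> (s n) + b *\<^sub>R \<iota> (t n)) (\<iota> (r n))) \<longlonglongrightarrow> polar (a *\<^sub>R x + b *\<^sub>R y) z"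
      by (intro tendsto_polar tendsto_intros s t r)
    moreover have "(\<lambda>n. a * polar (\<iota> (s n)) (\<iota> (r n)) + b * polar (\<iota> (t n)) (\<iota> (r n)))
        \<longlonglongrightarrow> a * polar x z + b * polar y z"
      by (intro tendsto_polar tendsto_intros s t r)
    moreover have "polar (a *\<^sub>R \<iota> (s n) + b *\<^sub>R \<iota> (t n)) (\<iota> (r n))
        = a * polar (\<iota> (s n)) (\<iota> (r n)) + b * polar (\<iota> (t n)) (\<iota> (r n))" for n
      using s(1)[of n] t(1)[of n] r(1)[of n]
      by (simp add: image_lincomb[symmetric] polar_image Q_lincomb[OF S] Theta_lincomb[OF S(1)])
    ultimately show ?thesis using LIMSEQ_unique by simp
  qed
  show ?thesis
  proof (rule linearI)
    show "polar (x + y) z = polar x z + polar y z" for x y :: 'h using *[of 1 x 1 y] by simp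
    show "polar (r *\<^sub>R x) z = r *\<^sub>R polar x z" for r and x :: 'h using *[of r x 0 x] by simp
  qed
qed

text \<open>A continuous function on the product is determined by its values on pairs of images of controls,
  so the definite description in \<^const>\<open>Q_ext\<close> denotes the polarized norm.\<close>

lemma Q_ext_eq: "Q_ext S \<iota> (x, y) = polar x y"
proof -
  define p where "p = (\<lambda>(x::'h, y). polar x y)"
  have cont: "continuous_on UNIV p"
    unfolding p_def polar_def case_prod_unfold by (intro continuous_intros) auto
  have ext: "\<forall>\<sigma>\<in>Theta S. \<forall>\<mu>\<in>Theta S. p (\<iota> \<sigma>, \<iota> \<mu>) = Q S \<sigma> \<mu>"
    by (simp add: p_def polar_image)
  have "Q_ext S \<iota> = p"
    unfolding Q_ext_def
  proof (rule the_equality)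
    fix q assume q: "continuous_on UNIV q \<and> (\<forall>\<sigma>\<in>Theta S. \<forall>\<mu>\<in>Theta S. q (\<iota> \<sigma>, \<iota> \<mu>) = Q S \<sigma> \<mu>)"
    show "q = p"
    proof (rule continuous_eq_on_dense)
      show "closure (\<iota> ` Theta S \<times> \<iota> ` Theta S) = UNIV" by (simp add: closure_Times dense_image)
      show "q x = p x" if "x \<in> \<iota> ` Theta S \<times> \<iota> ` Theta S" for x
        using that q ext by auto
    qed (use q cont in auto)
  qed (use cont ext in auto)
  then show ?thesis by (simp add: p_def)
qed

text \<open>The map \<open>\<iota>\<close> need not be injective, so \<^const>\<open>F\<close> does not directly define a function on its image. The
  bound by the energy norm, applied to a difference of controls, settles this: controls with equal
  images have equal values of \<^const>\<open>F\<close>, and the induced function on the image is Lipschitz.\<close>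

lemma bounded_linear_F_ext: "bounded_linear (F_ext S \<iota>)"
proof -
  define C where "C = L2_norm (Om_o S) (u0_diff S)"
  have C: "0 \<le> C" by (simp add: C_def L2_norm_def L2_inner_nonneg)
  have lip: "\<bar>F S \<sigma> - F S \<mu>\<bar> \<le> C * norm (\<iota> \<sigma> - \<iota> \<mu>)" if "\<sigma> \<in> Theta S" "\<mu> \<in> Theta S" for \<sigma> \<mu>
  proof -
    have l: "lincomb 1 \<sigma> (-1) \<mu> \<in> Theta S" by (rule Theta_lincomb[OF S(1) that])
    show ?thesis
      using F_bounded[OF S l] F_lincomb[OF S that, of 1 "-1"] norm_image[OF l] image_lincomb[OF that, of 1 "-1"]
      by (simp add: C_def)
  qed
  \<comment> \<open>The functional on the image of the controls, through an arbitrary preimage.\<close>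
  define f where "f x = F S (SOME \<sigma>. \<sigma> \<in> Theta S \<and> \<iota> \<sigma> = x)" for x
  have f: "f (\<iota> \<sigma>) = F S \<sigma>" if \<sigma>: "\<sigma> \<in> Theta S" for \<sigma>
  proof -
    define \<mu> where "\<mu> = (SOME \<mu>. \<mu> \<in> Theta S \<and> \<iota> \<mu> = \<iota> \<sigma>)"
    have "\<mu> \<in> Theta S \<and> \<iota> \<mu> = \<iota> \<sigma>" unfolding \<mu>_def by (rule someI[of _ \<sigma>]) (simp add: \<sigma>)
    then show ?thesis using lip[of \<mu> \<sigma>] \<sigma> by (simp add: f_def \<mu>_def[symmetric])
  qed
  have "C-lipschitz_on (\<iota> ` Theta S) f"
    by (rule lipschitz_onI) (use lip C in \<open>auto simp: f dist_norm\<close>)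
  then obtain g where g: "C-lipschitz_on UNIV g" "\<And>x. x \<in> \<iota> ` Theta S \<Longrightarrow> g x = f x"
    using lipschitz_extend_closure[of C "\<iota> ` Theta S" f] dense_image by auto
  have gF: "g (\<iota> \<sigma>) = F S \<sigma>" if "\<sigma> \<in> Theta S" for \<sigma> using g(2) f that by simp
  have cont: "continuous_on UNIV g" by (rule lipschitz_on_continuous_on[OF g(1)])
  have lim: "(\<lambda>n. g (X n)) \<longlonglongrightarrow> g x" if "X \<longlonglongrightarrow> x" for X x
    using cont that by (auto intro: continuous_on_tendsto_compose)
  have "F_ext S \<iota> = g"
    unfolding F_ext_def
  proof (rule the_equality)
    fix l assume l: "continuous_on UNIV l \<and> (\<forall>\<mu>\<in>Theta S. l (\<iota> \<mu>) = F S \<mu>)"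
    show "l = g" by (rule continuous_eq_on_dense[OF _ cont dense_image]) (use l gF in auto)
  qed (use cont gF in auto)
  moreover have *: "g (a *\<^sub>R x + b *\<^sub>R y) = a * g x + b * g y" for a b x y
  proof -
    obtain s t where s: "\<And>n. s n \<in> Theta S" "(\<lambda>n. \<iota> (s n)) \<longlonglongrightarrow> x"
      and t: "\<And>n. t n \<in> Theta S" "(\<lambda>n. \<iota> (t n)) \<longlonglongrightarrow> y"
      using approx_by_controls by metis
    have "(\<lambda>n. g (a *\<^sub>R \<iota> (s n) + b *\<^sub>R \<iota> (t n))) \<longlonglongrightarrow> g (a *\<^sub>R x + b *\<^sub>R y)"
      by (intro lim tendsto_intros s t)
    moreover have "(\<lambda>n. a * g (\<iota> (s n)) + b * g (\<iota> (t n))) \<longlonglongrightarrow> a * g x + b * g y"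
      by (intro lim tendsto_intros s t)
    moreover have "g (a *\<^sub>R \<iota> (s n) + b *\<^sub>R \<iota> (t n)) = a * g (\<iota> (s n)) + b * g (\<iota> (t n))" for n
      using s(1)[of n] t(1)[of n]
      by (simp add: image_lincomb[symmetric] gF F_lincomb[OF S] Theta_lincomb[OF S(1)])
    ultimately show ?thesis using LIMSEQ_unique by simp
  qed
  moreover have "bounded_linear g"
  proof (rule bounded_linear_intro)
    show "g (x + y) = g x + g y" for x y using *[of 1 x 1 y] by simp
    show "g (r *\<^sub>R x) = r *\<^sub>R g x" for r x using *[of r x 0 x] by simp
    show "norm (g x) \<le> norm x * C" for x
      using lipschitz_onD[OF g(1), of x 0] *[of 0 0 0 0] by (simp add: dist_norm mult.commute)
  qed
  ultimately show ?thesis by simp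
qed

end

theorem theorem3p1:
  fixes S :: "('a::euclidean_space) coupling"
    and \<iota> :: "'a control \<Rightarrow> 'h::banach"
  assumes "DIM('a) \<in> {2, 3}"
    and "coupling_setting S"
    and "uniquely_solvable S"
    and "is_completion S \<iota>"
  shows "\<exists>\<theta>s::'h.
           (\<forall>\<theta>. J_ext S \<iota> \<theta>s \<le> J_ext S \<iota> \<theta>) \<and>
           (\<forall>\<theta>'. (\<forall>\<theta>. J_ext S \<iota> \<theta>' \<le> J_ext S \<iota> \<theta>) \<longrightarrow> \<theta>' = \<theta>s) \<and>
           (\<forall>\<mu>. Q_ext S \<iota> (\<theta>s, \<mu>) = F_ext S \<iota> \<mu>)"
  using polar_form_minimizer[of polar "F_ext S \<iota>",
      OF linear_polar[OF assms(2-4)] polar_commute polar_self bounded_linear_F_ext[OF assms(2-4)]]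
  by (simp add: J_ext_def Q_ext_eq[OF assms(2-4)])

end
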